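(* Let $r>0$, let $P_0\in\mathcal{M}(\mathbb{R}^{N_x})$ be absolutely continuous with respect to the Lebesgue measure on $\mathbb{R}^{N_x}$, let $\mathcal{P}:=\{P\in\mathcal{M}(\mathbb{R}^{N_x})\mid W_2(P,P_0)\le r\}$ and $M_0:=\mathbb{E}_{P_0}[ww^\top]$. Suppose that $K^\star\notin\mathcal{K}$. Then the minimax regret optimal control problem $$\inf_{K\in\mathcal{K}}\ \sup_{P\in\mathcal{P}}\ \mathbb{E}_P[R(K,w)]$$ is equivalent to the following semidefinite program in the decision variables $K,\gamma,X$: $$\begin{aligned} \inf\quad & \gamma\,(r^2-\mathrm{Tr}(M_0))+\mathrm{Tr}(X)\\ \text{s.t.}\quad & K\in\mathcal{K},\quad \gamma\ge 0,\quad X\in\mathbb{S}_+^{N_x},\\ &\begin{bmatrix}\gamma I & (K-K^\star)^\top\\ K-K^\star & D^{-1}\end{bmatrix}\succ 0,\\ &\begin{bmatrix}X & \gamma M_0^{1/2} & 0_{N_u\times N_x}^\top\\ \gamma M_0^{1/2} & \gamma I & (K-K^\star)^\top\\ 0_{N_u\times N_x} & K-K^\star & D^{-1}\end{bmatrix}\succeq 0, \end{aligned}$$ where $0_{N_u\times N_x}$ is the $N_u\times N_x$ zero matrix. Here equivalence means: for every $K\in\mathcal{K}$, the worst-case expected regret $\sup_{P\in\mathcal{P}}\mathbb{E}_P[R(K,w)]$ equals the infimum of the objective of the semidefinite program over all $(\gamma,X)$ such that $(K,\gamma,X)$ is feasible; in particular, the two problems have the same optimal value.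
   Context: **Matrices and measures.** $\mathbb{S}_+^{N}$ and $\mathbb{S}_{++}^{N}$ are the cones of real symmetric positive semidefinite and positive definite $N\times N$ matrices; $A\succeq B$ (resp. $A\succ B$) means $A-B$ is symmetric positive semidefinite (resp. positive definite); $A^{1/2}$ is the symmetric positive semidefinite square root of $A\in\mathbb{S}^N_+$. $\mathcal{M}(\mathbb{R}^{N})$ is the collection of Borel probability measures on $\mathbb{R}^{N}$ with finite second moments. $\mathbb{E}_P$ denotes expectation when the random vector $w$ has distribution $P$. The type-2 Wasserstein distance is $$W_2(P_1,P_2)^2:=\inf_{\pi\in\Pi(P_1,P_2)}\int\|z_1-z_2\|^2\,\pi(dz_1,dz_2),$$ where $\|\cdot\|$ is the Euclidean norm and $\Pi(P_1,P_2)$ is the set of joint distributions in $\mathcal{M}(\mathbb{R}^{N_x}\times\mathbb{R}^{N_x})$ with marginals $P_1,P_2\in\mathcal{M}(\mathbb{R}^{N_x})$. **System.** Let $n,m,T$ be positive integers, $N_x:=n(T+1)$, $N_u:=mT$, and let $A_t\in\mathbb{R}^{n\times n}$, $B_t\in\mathbb{R}^{n\times m}$ ($t=0,\dots,T-1$) be given. The system is $x_{t+1}=A_tx_t+B_tu_t+w_t$, $t=0,\dots,T-1$. The trajectories are $x=(x_0,\dots,x_T)\in\mathbb{R}^{N_x}$, $u=(u_0,\dots,u_{T-1})\in\mathbb{R}^{N_u}$, $w=(x_0,w_0,\dots,w_{T-1})\in\mathbb{R}^{N_x}$ (the initial state is the first block of $w$, with convention $w_{-1}:=x_0$). The dynamics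 are written as $x=Fu+Gw$, where $F\in\mathbb{R}^{N_x\times N_u}$ and $G\in\mathbb{R}^{N_x\times N_x}$ are the block lower-triangular matrices determined by the dynamics: with $\Phi(t,k):=A_{t-1}A_{t-2}\cdots A_k$ for $t>k$ and $\Phi(t,t):=I$, the blocks are $G_{t,k}=\Phi(t,k)$ for $0\le k\le t\le T$ and $0$ otherwise, and $F_{t,s}=\Phi(t,s+1)B_s$ for $0\le s<t\le T$ and $0$ otherwise. **Cost.** $J(u,w):=x^\top Qx+u^\top Ru$ with $x=Fu+Gw$, where $Q\in\mathbb{S}_+^{N_x}$ and $R\in\mathbb{S}_{++}^{N_u}$ are given. **Controllers.** $\mathcal{K}\subseteq\mathbb{R}^{N_u\times N_x}$ is the linear space of block lower-triangular matrices $K$ with blocks $K_{t,k}\in\mathbb{R}^{m\times n}$ ($t=0,\dots,T-1$, $k=0,\dots,T$) and $K_{t,k}=0$ for $k>t$; it represents the strictly causal linear disturbance feedback controllers $u=Kw$, i.e. $u_t=\sum_{k=0}^tK_{t,k}w_{k-1}$. **Regret.** The optimal noncausal controller is $u^\star(w):=\operatorname{argmin}_{u\in\mathbb{R}^{N_u}}J(u,w)$, which is given by $u^\star(w)=K^\star w$ with $K^\star:=-(R+F^\top QF)^{-1}F^\top QG$. Set $D:=R+F^\top QF$, which is positive definite. The regret of $K\in\mathcal{K}$ under disturbance $w$ is $R(K,w):=J(Kw,w)-J(u^\star(w),w)$ (the two-argument function $R(\cdot,\cdot)$ is distinct from the cost matrix $R$). *)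

theory Defs
  imports "HOL-Probability.Probability"
begin

section \<open>Symmetric semidefinite and definite matrices, block matrices\<close>

definition psd :: "real^'i^'i \<Rightarrow> bool" where
  "psd A \<longleftrightarrow> transpose A = A \<and> (\<forall>v. 0 \<le> v \<bullet> (A *v v))"

definition pd :: "real^'i^'i \<Rightarrow> bool" where
  "pd A \<longleftrightarrow> transpose A = A \<and> (\<forall>v. v \<noteq> 0 \<longrightarrow> 0 < v \<bullet> (A *v v))"

definition msqrt :: "real^'i^'i \<Rightarrow> real^'i^'i" where
  "msqrt A = (THE S. psd S \<and> S ** S = A)"

definition hcat :: "real^'a^'r \<Rightarrow> real^'b^'r \<Rightarrow> real^('a + 'b)^'r" where
  "hcat A B = (\<chi> i j. case j of Inl a \<Rightarrow> A $ i $ a | Inr b \<Rightarrow> B $ i $ b)"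

definition vcat :: "real^'c^'a \<Rightarrow> real^'c^'b \<Rightarrow> real^'c^('a + 'b)" where
  "vcat A B = (\<chi> i. case i of Inl a \<Rightarrow> A $ a | Inr b \<Rightarrow> B $ b)"


section \<open>Probability measures with finite second moment, Wasserstein distance\<close>

definition prob2 :: "'a::euclidean_space measure set" where
  "prob2 = {P. prob_space P \<and> sets P = sets borel \<and> integrable P (\<lambda>z. (norm z)\<^sup>2)}"

definition couplings ::
    "'a::euclidean_space measure \<Rightarrow> 'a measure \<Rightarrow> ('a \<times> 'a) measure set" where
  "couplings P1 P2 = {\<pi> \<in> prob2. distr \<pi> borel fst = P1 \<and> distr \<pi> borel snd = P2}"

text \<open>For \<open>P1\<close>, \<open>P2\<close> in \<^const>\<open>prob2\<close> the set of couplings contains the product measure and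
  the transport costs are finite and nonnegative, so the real-valued infimum is the usual one.\<close>

definition wasserstein2 :: "'a::euclidean_space measure \<Rightarrow> 'a measure \<Rightarrow> real" where
  "wasserstein2 P1 P2 =
     sqrt (INF \<pi>\<in>couplings P1 P2. \<integral>z. (norm (fst z - snd z))\<^sup>2 \<partial>\<pi>)"

definition ambiguity :: "'a::euclidean_space measure \<Rightarrow> real \<Rightarrow> 'a measure set" where
  "ambiguity P0 r = {P \<in> prob2. wasserstein2 P P0 \<le> r}"

definition second_moment :: "(real^'i) measure \<Rightarrow> real^'i^'i" where
  "second_moment P = (\<chi> i j. \<integral>w. w $ i * w $ j \<partial>P)"


section \<open>Trajectories of the linear system\<close>

text \<open>
  The horizon \<open>T \<ge> 1\<close> is \<open>CARD('t)\<close> for a finite linear order \<open>'t\<close>, whose elements are numbered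
  \<open>0, \<dots>, T - 1\<close> by \<open>time\<close>; likewise \<open>n = CARD('n)\<close> and \<open>m = CARD('m)\<close>. The type \<open>'t option\<close>
  stands for the \<open>T + 1\<close> block positions \<open>0, \<dots>, T\<close> of \<open>x\<close> and \<open>w\<close>, numbered by \<open>block\<close>: the
  block at \<open>Some t\<close> is the state following step \<open>t\<close>, respectively the disturbance \<open>w\<^sub>t\<close>, and the
  block at \<open>None\<close> is the initial state. A pair \<open>(p, i)\<close> indexes coordinate \<open>i\<close> of block \<open>p\<close>.
\<close>

type_synonym ('n, 't) xvec = "real^('t option \<times> 'n)"
type_synonym ('m, 't) uvec = "real^('t \<times> 'm)"

definition time :: "'t::{finite,linorder} \<Rightarrow> nat" where
  "time t = card {s. s < t}"

definition block :: "'t::{finite,linorder} option \<Rightarrow> nat" where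
  "block p = (case p of None \<Rightarrow> 0 | Some t \<Rightarrow> time t + 1)"

text \<open>\<open>Phi A t k\<close> is \<open>A (t - 1) ** \<dots> ** A k\<close> for \<open>k < t\<close> and the identity for \<open>k = t\<close>; it is
  used only for \<open>k \<le> t \<le> T\<close>, so that only \<open>A 0, \<dots>, A (T - 1)\<close> matter.\<close>

primrec Phi :: "(nat \<Rightarrow> real^'n^'n) \<Rightarrow> nat \<Rightarrow> nat \<Rightarrow> real^'n^'n" where
  "Phi A 0 k = mat 1"
| "Phi A (Suc t) k = (if k \<le> t then A t ** Phi A t k else mat 1)"

definition Gmat ::
    "(nat \<Rightarrow> real^'n^'n) \<Rightarrow> real^('t::{finite,linorder} option \<times> 'n)^('t option \<times> 'n)" where
  "Gmat A = (\<chi> a b. case (a, b) of ((p, i), (q, j)) \<Rightarrow>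
     if block q \<le> block p then Phi A (block p) (block q) $ i $ j else 0)"

definition Fmat ::
    "(nat \<Rightarrow> real^'n^'n) \<Rightarrow> (nat \<Rightarrow> real^'m^'n) \<Rightarrow>
       real^('t::{finite,linorder} \<times> 'm)^('t option \<times> 'n)" where
  "Fmat A B = (\<chi> a b. case (a, b) of ((p, i), (s, j)) \<Rightarrow>
     if time s < block p then (Phi A (block p) (time s + 1) ** B (time s)) $ i $ j else 0)"

text \<open>With these definitions \<open>x = Fmat A B *v u + Gmat A *v w\<close> satisfies the recursion
  \<open>x\<^sub>0 = w\<^sub>-\<^sub>1\<close>, \<open>x\<^sub>t\<^sub>+\<^sub>1 = A\<^sub>t x\<^sub>t + B\<^sub>t u\<^sub>t + w\<^sub>t\<close>.\<close>

definition blk :: "real^('p::finite \<times> 'i::finite) \<Rightarrow> 'p \<Rightarrow> real^'i" where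
  "blk v p = (\<chi> i. v $ (p, i))"

lemma inj_time: "time s = time t \<longleftrightarrow> s = t"
proof
  have *: "time s < time t" if "s < t" for s t :: 'a
    unfolding time_def using that by (intro psubset_card_mono) auto
  assume "time s = time t" then show "s = t"
    using *[of s t] *[of t s] by (cases s t rule: linorder_cases) auto
qed simp

lemma inj_block: "block p = block q \<longleftrightarrow> p = q"
  by (auto simp: block_def inj_time split: option.splits)

lemma blk_F:
  "blk (Fmat A B *v u) p =
     (\<Sum>s | time s < block p. (Phi A (block p) (time s + 1) ** B (time s)) *v blk u s)"
proof -
  have "(Fmat A B *v u) $ (p, i) =
     (\<Sum>s | time s < block p. (Phi A (block p) (time s + 1) ** B (time s)) *v blk u s) $ i" for i
  proof -
    have "(Fmat A B *v u) $ (p, i) = (\<Sum>s\<in>UNIV. \<Sum>j\<in>UNIV. (if time s < block p then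
        (Phi A (block p) (time s + 1) ** B (time s)) $ i $ j else 0) * u $ (s, j))"
      unfolding sum.cartesian_product UNIV_Times_UNIV
      by (auto simp: matrix_vector_mult_def Fmat_def intro!: sum.cong)
    also have "\<dots> = (\<Sum>s\<in>UNIV. if time s < block p then
        ((Phi A (block p) (time s + 1) ** B (time s)) *v blk u s) $ i else 0)"
      by (intro sum.cong) (auto simp: matrix_vector_mult_def blk_def)
    finally show ?thesis by (simp add: sum.inter_filter[symmetric])
  qed
  then show ?thesis by (simp add: vec_eq_iff blk_def[where p = p])
qed

lemma blk_G:
  "blk (Gmat A *v w) p = (\<Sum>q | block q \<le> block p. Phi A (block p) (block q) *v blk w q)"
proof -
  have "(Gmat A *v w) $ (p, i) =
     (\<Sum>q | block q \<le> block p. Phi A (block p) (block q) *v blk w q) $ i" for i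
  proof -
    have "(Gmat A *v w) $ (p, i) = (\<Sum>q\<in>UNIV. \<Sum>j\<in>UNIV. (if block q \<le> block p then
        Phi A (block p) (block q) $ i $ j else 0) * w $ (q, j))"
      unfolding sum.cartesian_product UNIV_Times_UNIV
      by (auto simp: matrix_vector_mult_def Gmat_def intro!: sum.cong)
    also have "\<dots> = (\<Sum>q\<in>UNIV. if block q \<le> block p then
        (Phi A (block p) (block q) *v blk w q) $ i else 0)"
      by (intro sum.cong) (auto simp: matrix_vector_mult_def blk_def)
    finally show ?thesis by (simp add: sum.inter_filter[symmetric])
  qed
  then show ?thesis by (simp add: vec_eq_iff blk_def[where p = p])
qed

lemma Phi_refl: "Phi A t t = mat 1"
  by (cases t) auto

lemma dynamics:
  fixes x :: "('n::finite, 't::{finite,linorder}) xvec"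
  assumes "x = Fmat A B *v u + Gmat A *v w"
  shows "blk x None = blk w None"
    and "block p = time t \<Longrightarrow>
      blk x (Some t) = A (time t) *v blk x p + B (time t) *v blk u t + blk w (Some t)"
proof -
  have x: "blk x p = blk (Fmat A B *v u) p + blk (Gmat A *v w) p" for p
    by (simp add: assms blk_def vec_eq_iff)
  have b0: "block None = 0" and bS: "block (Some t) = Suc (time t)" for t :: 't
    by (simp_all add: block_def)
  have "{q :: 't option. block q = 0} = {None}"
    using inj_block[of _ None] by (auto simp: b0)
  then show "blk x None = blk w None"
    by (simp add: x blk_F blk_G b0)
  assume p: "block p = time t"
  have "{s. time s < Suc (time t)} = insert t {s. time s < time t}"
    by (auto simp: less_Suc_eq inj_time)
  then have F: "blk (Fmat A B *v u) (Some t) =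
      A (time t) *v blk (Fmat A B *v u) p + B (time t) *v blk u t"
    by (simp add: blk_F bS p Phi_refl vec.sum matrix_mul_assoc[symmetric]
        matrix_vector_mul_assoc[symmetric])
  have "{q. block q \<le> Suc (time t)} = insert (Some t) {q. block q \<le> time t}"
    using inj_block[of _ "Some t"] by (auto simp: le_Suc_eq bS)
  then have G: "blk (Gmat A *v w) (Some t) = A (time t) *v blk (Gmat A *v w) p + blk w (Some t)"
    by (simp add: blk_G bS p Phi_refl vec.sum matrix_vector_mul_assoc[symmetric])
  show "blk x (Some t) = A (time t) *v blk x p + B (time t) *v blk u t + blk w (Some t)"
    by (simp add: x F G matrix_vector_right_distrib)
qed

definition causal ::
    "(real^('t::{finite,linorder} option \<times> 'n::finite)^('t \<times> 'm::finite)) set" where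
  "causal = {K. \<forall>t i q j. block q > time t \<longrightarrow> K $ (t, i) $ (q, j) = 0}"


section \<open>Cost and regret\<close>

definition cost ::
    "(nat \<Rightarrow> real^'n^'n) \<Rightarrow> (nat \<Rightarrow> real^'m^'n) \<Rightarrow>
     real^('t::{finite,linorder} option \<times> 'n)^('t option \<times> 'n) \<Rightarrow>
     real^('t \<times> 'm)^('t \<times> 'm) \<Rightarrow> ('m, 't) uvec \<Rightarrow> ('n, 't) xvec \<Rightarrow> real" where
  "cost A B Q R u w =
     (let x = Fmat A B *v u + Gmat A *v w in x \<bullet> (Q *v x) + u \<bullet> (R *v u))"

definition ustar ::
    "(nat \<Rightarrow> real^'n^'n) \<Rightarrow> (nat \<Rightarrow> real^'m^'n) \<Rightarrow>
     real^('t::{finite,linorder} option \<times> 'n)^('t option \<times> 'n) \<Rightarrow>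
     real^('t \<times> 'm)^('t \<times> 'm) \<Rightarrow> ('n, 't) xvec \<Rightarrow> ('m, 't) uvec" where
  "ustar A B Q R w = arg_min (\<lambda>u. cost A B Q R u w) (\<lambda>u. True)"

definition regret ::
    "(nat \<Rightarrow> real^'n^'n) \<Rightarrow> (nat \<Rightarrow> real^'m^'n) \<Rightarrow>
     real^('t::{finite,linorder} option \<times> 'n)^('t option \<times> 'n) \<Rightarrow>
     real^('t \<times> 'm)^('t \<times> 'm) \<Rightarrow> real^('t option \<times> 'n)^('t \<times> 'm) \<Rightarrow>
     ('n, 't) xvec \<Rightarrow> real" where
  "regret A B Q R K w = cost A B Q R (K *v w) w - cost A B Q R (ustar A B Q R w) w"

definition Dmat ::
    "(nat \<Rightarrow> real^'n^'n) \<Rightarrow> (nat \<Rightarrow> real^'m^'n) \<Rightarrow>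
     real^('t::{finite,linorder} option \<times> 'n)^('t option \<times> 'n) \<Rightarrow>
     real^('t \<times> 'm)^('t \<times> 'm) \<Rightarrow> real^('t \<times> 'm)^('t \<times> 'm)" where
  "Dmat A B Q R = R + transpose (Fmat A B) ** Q ** Fmat A B"

definition Kstar ::
    "(nat \<Rightarrow> real^'n^'n) \<Rightarrow> (nat \<Rightarrow> real^'m^'n) \<Rightarrow>
     real^('t::{finite,linorder} option \<times> 'n)^('t option \<times> 'n) \<Rightarrow>
     real^('t \<times> 'm)^('t \<times> 'm) \<Rightarrow> real^('t option \<times> 'n)^('t \<times> 'm)" where
  "Kstar A B Q R = - (matrix_inv (Dmat A B Q R) ** transpose (Fmat A B) ** Q ** Gmat A)"

text \<open>Suprema and infima are taken in \<^typ>\<open>ereal\<close>, so that no boundedness or feasibility is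
  presupposed.\<close>

definition worst_case_regret ::
    "(nat \<Rightarrow> real^'n^'n) \<Rightarrow> (nat \<Rightarrow> real^'m^'n) \<Rightarrow>
     real^('t::{finite,linorder} option \<times> 'n)^('t option \<times> 'n) \<Rightarrow>
     real^('t \<times> 'm)^('t \<times> 'm) \<Rightarrow> ('n, 't) xvec measure \<Rightarrow> real \<Rightarrow>
     real^('t option \<times> 'n)^('t \<times> 'm) \<Rightarrow> ereal" where
  "worst_case_regret A B Q R P0 r K =
     (SUP P\<in>ambiguity P0 r. ereal (\<integral>w. regret A B Q R K w \<partial>P))"


section \<open>The semidefinite program\<close>

definition sdp_feasible ::
    "(nat \<Rightarrow> real^'n^'n) \<Rightarrow> (nat \<Rightarrow> real^'m^'n) \<Rightarrow>
     real^('t::{finite,linorder} option \<times> 'n)^('t option \<times> 'n) \<Rightarrow>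
     real^('t \<times> 'm)^('t \<times> 'm) \<Rightarrow> real^('t option \<times> 'n)^('t option \<times> 'n) \<Rightarrow>
     ((real^('t option \<times> 'n)^('t \<times> 'm)) \<times> real \<times> (real^('t option \<times> 'n)^('t option \<times> 'n))) set"
  where
  "sdp_feasible A B Q R M0 = {(K, \<gamma>, X).
     K \<in> causal \<and> \<gamma> \<ge> 0 \<and> psd X \<and>
     (let L = K - Kstar A B Q R; Di = matrix_inv (Dmat A B Q R); S = msqrt M0 in
        pd (vcat (hcat (mat \<gamma>) (transpose L))
                 (hcat L       Di)) \<and>
        psd (vcat (hcat X             (hcat (\<gamma> *\<^sub>R S) (transpose 0)))
            (vcat (hcat (\<gamma> *\<^sub>R S)    (hcat (mat \<gamma>)   (transpose L)))
                  (hcat 0             (hcat L         Di)))))}"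

definition sdp_objective :: "real^'i^'i \<Rightarrow> real \<Rightarrow> real \<Rightarrow> real^'i^'i \<Rightarrow> real" where
  "sdp_objective M0 r \<gamma> X = \<gamma> * (r\<^sup>2 - trace M0) + trace X"

end

theory Submission
  imports Defs
begin

text \<open>
  Completing the square in the cost shows that the regret of \<open>K\<close> is the quadratic form
  \<open>w \<bullet> C w\<close> with \<open>C = L\<^sup>T D L\<close>, \<open>L = K - K\<^sup>*\<close> (\<open>regret_form\<close>). As \<open>K\<^sup>*\<close> is not causal, \<open>C\<close>
  is a nonzero psd matrix for each causal \<open>K\<close>, and the claim is Lagrangian duality for maximising
  the mean of a quadratic form over a Wasserstein ball.

  Fix an orthonormal eigenbasis of \<open>C\<close> with eigenvalues \<open>c b\<close> and let \<open>m b\<close> be the second moment of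
  \<open>P0\<close> in direction \<open>b\<close>. Both problems decouple into scalar ones, linked by a multiplier \<open>\<gamma>\<close>:

  \<^item> The definite constraint says that \<open>\<gamma> I - C\<close> is positive definite, that is \<open>c b < \<gamma>\<close> for all
    \<open>b\<close>. The semidefinite one says that \<open>X\<close> dominates a Schur complement, which is therefore the
    best choice of \<open>X\<close> and gives the objective the value
    \<open>f(\<gamma>) = \<gamma> r\<^sup>2 + \<Sum>b. m b * \<gamma> * c b / (\<gamma> - c b)\<close>
    (\<open>schur_definite\<close>, \<open>schur_semidefinite\<close>, \<open>sdp_minimum_over_X\<close>).

  \<^item> Each \<open>f(\<gamma>)\<close> bounds the expected regret over the ball, by integrating a pointwise inequality
    against a coupling (\<open>wasserstein_weak_duality\<close>).

  \<^item> The bound is attained. Absolute continuity makes every \<open>m b\<close> positive, so \<open>f'\<close> runs from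
    minus infinity at the largest eigenvalue to \<open>r\<^sup>2\<close> at infinity and has a zero \<open>\<gamma>\<close>. The image
    of \<open>P0\<close> under the linear map \<open>\<gamma> (\<gamma> I - C)\<^sup>-\<^sup>1\<close> then lies at transport cost at most \<open>r\<^sup>2\<close> from
    \<open>P0\<close>, and its expected regret is \<open>f(\<gamma>)\<close> (\<open>wasserstein_strong_duality\<close>).

  The spectral theorem for symmetric real matrices (\<open>symmetric_eigenbasis\<close>) supplies the eigenbasis
  of \<open>C\<close> and also the psd square root of the second moment matrix (\<open>msqrt\<close>).
\<close>

section \<open>Orthonormal eigenbases of self-adjoint maps\<close>

text \<open>Eigenbases are sets rather than indexed families, so that an orthonormal basis of a
  subspace extends by \<open>insert\<close> in the induction below.\<close>

definition orthonormal_basis :: "'a::euclidean_space set \<Rightarrow> bool" where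
  "orthonormal_basis B \<longleftrightarrow>
     finite B \<and> pairwise orthogonal B \<and> (\<forall>b\<in>B. norm b = 1) \<and> span B = UNIV"

lemma orthonormal_basis_expansion:
  assumes "orthonormal_basis B"
  shows "(\<Sum>b\<in>B. (x \<bullet> b) *\<^sub>R b) = x"
  using assms orthonormal_basis_expand[of B x] by (auto simp: orthonormal_basis_def)

lemma orthonormal_basis_parseval:
  assumes "orthonormal_basis B"
  shows "x \<bullet> y = (\<Sum>b\<in>B. (x \<bullet> b) * (y \<bullet> b))"
proof -
  have "x \<bullet> y = x \<bullet> (\<Sum>b\<in>B. (y \<bullet> b) *\<^sub>R b)"
    by (simp add: orthonormal_basis_expansion[OF assms])
  then show ?thesis by (simp add: inner_sum_right mult.commute)
qed

text \<open>Matrix identities are checked on an eigenbasis, where both sides act as scalars.\<close>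

lemma orthonormal_basis_eqI:
  assumes "orthonormal_basis B" and "linear f" and "linear g" and "\<And>b. b \<in> B \<Longrightarrow> f b = g b"
  shows "f x = g x"
  using linear_eq_on[OF assms(2,3), of x B] assms(1,4) by (auto simp: orthonormal_basis_def)

text \<open>A nonnegative quadratic form restricted to a line through a zero \<open>u\<close> of the form is
  \<open>2 t p + t\<^sup>2 q\<close>. Its minimum is at \<open>t = 0\<close>, so the linear coefficient vanishes.\<close>

lemma nonneg_form_null_vector:
  assumes "\<And>t::real. 0 \<le> 2 * t * p + t\<^sup>2 * q"
  shows "p = 0"
proof (rule ccontr)
  assume p: "p \<noteq> 0"
  have q: "0 \<le> 2 * p + q" "0 \<le> - 2 * p + q" using assms[of 1] assms[of "-1"] by auto
  then have q0: "q > 0" using p by linarith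
  have "2 * (- p / q) * p + (- p / q)\<^sup>2 * q = - (p\<^sup>2 / q)"
    using q0 by (simp add: power2_eq_square field_simps)
  also have "\<dots> < 0" using p q0 by simp
  finally show False using assms[of "- p / q"] by simp
qed

text \<open>A maximiser \<open>u\<close> of the Rayleigh quotient on an invariant subspace \<open>S\<close> is an eigenvector:
  with \<open>l\<close> the maximum, \<open>y \<mapsto> l (y \<bullet> y) - f y \<bullet> y\<close> is a nonnegative form on \<open>S\<close> that vanishes
  at \<open>u\<close>, hence \<open>f u - l u\<close> is orthogonal to \<open>S\<close> and, lying in \<open>S\<close>, is zero. The orthogonal
  complement of \<open>u\<close> in \<open>S\<close> is again invariant and has smaller dimension.\<close>

lemma self_adjoint_eigenbasis_subspace:
  fixes f :: "'a::euclidean_space \<Rightarrow> 'a"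
  assumes lin: "linear f" and sa: "\<And>x y. f x \<bullet> y = x \<bullet> f y"
    and "subspace S" and "f ` S \<subseteq> S"
  shows "\<exists>B. B \<subseteq> S \<and> finite B \<and> pairwise orthogonal B \<and> (\<forall>b\<in>B. norm b = 1) \<and>
    span B = S \<and> (\<forall>b\<in>B. f b = (f b \<bullet> b) *\<^sub>R b)"
  using assms(3,4)
proof (induction "dim S" arbitrary: S rule: less_induct)
  case less
  show ?case
  proof (cases "S = {0}")
    case True
    then show ?thesis by (intro exI[of _ "{}"]) auto
  next
    case False
    interpret f: linear f by (fact lin)
    obtain z where z: "z \<in> S" "z \<noteq> 0" using False subspace_0[OF less.prems(1)] by auto
    define U where "U = S \<inter> sphere 0 1"
    have "compact U"
      unfolding U_def using closed_subspace[OF less.prems(1)] by (simp add: closed_Int_compact)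
    moreover have "(1 / norm z) *\<^sub>R z \<in> U"
      using z less.prems(1) by (auto simp: U_def subspace_scale)
    then have "U \<noteq> {}" by auto
    moreover have "continuous_on U (\<lambda>x. f x \<bullet> x)"
      by (intro continuous_intros linear_continuous_on) (simp add: lin linear_linear)
    ultimately obtain u where u: "u \<in> U" and max: "\<And>x. x \<in> U \<Longrightarrow> f x \<bullet> x \<le> f u \<bullet> u"
      using continuous_attains_sup[of U "\<lambda>x. f x \<bullet> x"] by auto
    define l where "l = f u \<bullet> u"
    have uS: "u \<in> S" and nu: "norm u = 1" using u by (auto simp: U_def)
    have uu: "u \<bullet> u = 1" using nu by (simp add: dot_square_norm)
    have nonneg: "0 \<le> l * (y \<bullet> y) - f y \<bullet> y" if "y \<in> S" for y
    proof (cases "y = 0")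
      case False
      have "f ((1 / norm y) *\<^sub>R y) \<bullet> ((1 / norm y) *\<^sub>R y) \<le> l"
        unfolding l_def using False that less.prems(1)
        by (intro max) (auto simp: U_def subspace_scale)
      then show ?thesis
        using False by (simp add: f.scale dot_square_norm power2_eq_square field_simps)
    qed (simp add: f.zero)
    define g where "g = f u - l *\<^sub>R u"
    have gS: "g \<in> S" unfolding g_def
      using uS less.prems by (intro subspace_diff subspace_scale) auto
    \<comment> \<open>The nonnegative form evaluated at \<open>u + t g\<close>; its constant term vanishes.\<close>
    have "0 \<le> 2 * t * (- (g \<bullet> g)) + t\<^sup>2 * (l * (g \<bullet> g) - f g \<bullet> g)" for t
    proof -
      have "u + t *\<^sub>R g \<in> S" using uS gS less.prems(1) by (intro subspace_add subspace_scale)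
      from nonneg[OF this]
      have "0 \<le> l * (u \<bullet> u) - f u \<bullet> u + 2 * t * (l * (u \<bullet> g) - f u \<bullet> g)
          + t\<^sup>2 * (l * (g \<bullet> g) - f g \<bullet> g)"
        using sa[of g u]
        by (simp add: f.add f.scale inner_simps inner_commute power2_eq_square algebra_simps)
      moreover have "l * (u \<bullet> g) - f u \<bullet> g = - (g \<bullet> g)"
        by (simp add: g_def inner_simps algebra_simps inner_commute)
      ultimately show ?thesis by (simp add: uu l_def)
    qed
    then have "g = 0" using nonneg_form_null_vector by fastforce
    then have fu: "f u = l *\<^sub>R u" by (simp add: g_def)
    define S' where "S' = S \<inter> {x. u \<bullet> x = 0}"
    have sub': "subspace S'"
      unfolding S'_def using less.prems(1) subspace_hyperplane by (rule subspace_inter)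
    have inv': "f ` S' \<subseteq> S'"
    proof -
      have "u \<bullet> f x = l * (u \<bullet> x)" for x
        using sa[of u x] fu by simp
      then show ?thesis using less.prems(2) by (auto simp: S'_def)
    qed
    have "u \<notin> S'" using uu by (simp add: S'_def)
    moreover have "S' \<subseteq> S" by (simp add: S'_def)
    ultimately have "S' \<subset> S" using uS by blast
    then have "dim S' < dim S"
      using dim_psubset[of S' S] sub' less.prems(1) by (simp add: span_eq_iff[THEN iffD2])
    from less.hyps[OF this sub' inv'] obtain B where
      B: "B \<subseteq> S'" "finite B" "pairwise orthogonal B" "\<forall>b\<in>B. norm b = 1" "span B = S'"
        "\<forall>b\<in>B. f b = (f b \<bullet> b) *\<^sub>R b" by auto
    have "x \<in> span (insert u B)" if "x \<in> S" for x
    proof -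
      have "x - (u \<bullet> x) *\<^sub>R u \<in> S'"
        using that uS less.prems(1) uu
        by (auto simp: S'_def subspace_diff subspace_scale inner_simps)
      then show ?thesis unfolding span_insert using B(5) by blast
    qed
    moreover have "span (insert u B) \<subseteq> S"
      using B(1) uS less.prems(1) by (intro span_minimal) (auto simp: S'_def)
    ultimately have "span (insert u B) = S" by auto
    moreover have "pairwise orthogonal (insert u B)"
      using B(1,3) by (auto simp: pairwise_insert orthogonal_def S'_def inner_commute)
    ultimately show ?thesis
      using B uS nu fu uu by (intro exI[of _ "insert u B"]) (auto simp: S'_def)
  qed
qed

lemma inner_transpose: "(transpose A *v x) \<bullet> y = x \<bullet> (A *v y)" for A :: "real^'n^'m"
  by (simp add: transpose_matrix_vector dot_lmul_matrix)

text \<open>Writing the eigenvalue as the Rayleigh quotient \<open>b \<bullet> A b\<close> makes it a function of \<open>b\<close>, so no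
  separate choice of eigenvalues is needed.\<close>

theorem symmetric_eigenbasis:
  fixes A :: "real^'n^'n"
  assumes "transpose A = A"
  obtains B where "orthonormal_basis B" and "\<And>b. b \<in> B \<Longrightarrow> A *v b = (b \<bullet> (A *v b)) *\<^sub>R b"
proof -
  have "(A *v x) \<bullet> y = x \<bullet> (A *v y)" for x y
    using inner_transpose[of A x y] assms by simp
  from self_adjoint_eigenbasis_subspace[OF matrix_vector_mul_linear this, of UNIV]
  obtain B where "finite B \<and> pairwise orthogonal B \<and> (\<forall>b\<in>B. norm b = 1) \<and>
    span B = UNIV \<and> (\<forall>b\<in>B. A *v b = ((A *v b) \<bullet> b) *\<^sub>R b)" by auto
  then show ?thesis using that[of B] by (auto simp: orthonormal_basis_def inner_commute)
qed

text \<open>Parseval for two coordinate vectors reads \<open>\<Sum>b. b $ i * b $ j = \<delta>\<^sub>i\<^sub>j\<close>, so summing the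
  quadratic form of \<open>A\<close> over \<open>B\<close> picks out the diagonal.\<close>

lemma trace_orthonormal_basis:
  fixes A :: "real^'n^'n"
  assumes "orthonormal_basis B"
  shows "trace A = (\<Sum>b\<in>B. b \<bullet> (A *v b))"
proof -
  have delta: "(\<Sum>b\<in>B. b $ i * b $ j) = (if i = j then 1 else 0)" for i j :: 'n
    using orthonormal_basis_parseval[OF assms, of "axis i 1" "axis j 1", symmetric]
    by (simp add: inner_axis_axis inner_axis' inner_axis) (simp add: axis_def)
  have "(\<Sum>b\<in>B. b \<bullet> (A *v b)) = (\<Sum>b\<in>B. \<Sum>i\<in>UNIV. \<Sum>j\<in>UNIV. A $ i $ j * (b $ i * b $ j))"
    by (simp add: inner_vec_def matrix_vector_mult_def sum_distrib_left mult_ac)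
  also have "\<dots> = (\<Sum>i\<in>UNIV. \<Sum>j\<in>UNIV. A $ i $ j * (\<Sum>b\<in>B. b $ i * b $ j))"
    by (simp add: sum_distrib_left sum.swap[of _ _ B])
  also have "\<dots> = trace A" by (simp add: delta trace_def if_distrib cong: if_cong)
  finally show ?thesis by simp
qed

section \<open>The positive semidefinite square root\<close>

text \<open>Existence of the root: a psd matrix can be prescribed by nonnegative eigenvalues on an
  orthonormal basis.\<close>

lemma psd_diagonal:
  fixes B :: "(real^'n) set"
  assumes B: "orthonormal_basis B" and c: "\<And>b. b \<in> B \<Longrightarrow> 0 \<le> c b"
  obtains S :: "real^'n^'n" where "psd S" and "\<And>b. b \<in> B \<Longrightarrow> S *v b = c b *\<^sub>R b"
proof -
  define f where "f x = (\<Sum>b\<in>B. (c b * (x \<bullet> b)) *\<^sub>R b)" for x :: "real^'n"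
  have lin: "linear f"
    by (rule linearI)
      (simp_all add: f_def inner_simps algebra_simps sum.distrib scaleR_sum_right)
  have mat: "matrix f *v x = f x" for x
    using matrix_vector_mul(2)[OF lin] by metis
  have form: "f x \<bullet> y = (\<Sum>b\<in>B. c b * (x \<bullet> b) * (y \<bullet> b))" for x y
    by (simp add: f_def inner_sum_left inner_commute[of y])
  have "(transpose (matrix f) *v x) \<bullet> y = (matrix f *v x) \<bullet> y" for x y
    unfolding inner_transpose mat form by (subst inner_commute) (simp add: form mult_ac)
  then have "transpose (matrix f) *v x = matrix f *v x" for x
    using vector_eq_rdot by blast
  then have "transpose (matrix f) = matrix f" by (simp add: matrix_eq)
  moreover have "0 \<le> v \<bullet> (matrix f *v v)" for v
  proof -
    have "v \<bullet> (matrix f *v v) = (\<Sum>b\<in>B. c b * (v \<bullet> b)\<^sup>2)"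
      by (simp add: mat inner_commute[of v "f v"] form power2_eq_square mult.assoc)
    then show ?thesis using c by (simp add: sum_nonneg)
  qed
  ultimately have "psd (matrix f)" by (simp add: psd_def)
  moreover have "matrix f *v b = c b *\<^sub>R b" if "b \<in> B" for b
  proof -
    have "(c e * (b \<bullet> e)) *\<^sub>R e = (if e = b then c b *\<^sub>R b else 0)" if "e \<in> B" for e
      using B \<open>b \<in> B\<close> that
      by (auto simp: orthonormal_basis_def pairwise_def orthogonal_def dot_square_norm)
    then have "f b = (\<Sum>e\<in>B. if e = b then c b *\<^sub>R b else 0)"
      unfolding f_def by (rule sum.cong[OF refl])
    also have "\<dots> = c b *\<^sub>R b"
      using B that by (simp add: orthonormal_basis_def)
    finally show ?thesis by (simp add: mat)
  qed
  ultimately show ?thesis using that by blast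
qed

text \<open>An eigenvector of \<open>A\<close> with eigenvalue \<open>l\<close> is an eigenvector of every psd root \<open>S\<close>
  with eigenvalue \<open>sqrt l\<close>: for \<open>l > 0\<close> because \<open>(S + sqrt l) (S - sqrt l) b = 0\<close> and the first
  factor is positive definite, for \<open>l = 0\<close> because \<open>\<parallel>S b\<parallel>\<^sup>2 = b \<bullet> A b = 0\<close>.\<close>

lemma psd_root_eigenvector:
  fixes S :: "real^'n^'n"
  assumes S: "psd S" and b: "(S ** S) *v b = l *\<^sub>R b" and l: "0 \<le> l"
  shows "S *v b = sqrt l *\<^sub>R b"
proof -
  define y where "y = S *v b - sqrt l *\<^sub>R b"
  have SS: "S *v (S *v b) = l *\<^sub>R b" using b by (simp add: matrix_vector_mul_assoc)
  have sym: "transpose S = S" using S by (simp add: psd_def)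
  show ?thesis
  proof (cases "l = 0")
    case True
    have "(S *v b) \<bullet> (S *v b) = b \<bullet> (S *v (S *v b))"
      using inner_transpose[of S b "S *v b"] sym by simp
    then show ?thesis using True SS by simp
  next
    case False
    have "S *v y + sqrt l *\<^sub>R y = 0"
      using l by (simp add: y_def SS matrix_vector_mult_diff_distrib matrix_vector_mult_scaleR
          scaleR_diff_right)
    then have "y \<bullet> (S *v y) + sqrt l * (y \<bullet> y) = 0"
      by (metis inner_add_right inner_scaleR_right inner_zero_right)
    moreover have "0 \<le> y \<bullet> (S *v y)" using S by (simp add: psd_def)
    moreover have "0 \<le> sqrt l * (y \<bullet> y)" using l by simp
    ultimately have "sqrt l * (y \<bullet> y) = 0" by linarith
    then have "y = 0" using False l by simp
    then show ?thesis by (simp add: y_def)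
  qed
qed

text \<open>By the preceding lemma all psd roots agree on an eigenbasis of \<open>A\<close>, so the definite
  description in \<^const>\<open>msqrt\<close> denotes.\<close>

lemma msqrt:
  fixes A :: "real^'n^'n"
  assumes "psd A"
  shows "psd (msqrt A)" and "msqrt A ** msqrt A = A"
proof -
  obtain B where B: "orthonormal_basis B"
    and eig: "\<And>b. b \<in> B \<Longrightarrow> A *v b = (b \<bullet> (A *v b)) *\<^sub>R b"
    using symmetric_eigenbasis[of A] assms by (auto simp: psd_def)
  have nonneg: "0 \<le> b \<bullet> (A *v b)" for b using assms by (simp add: psd_def)
  obtain S where S: "psd S" "\<And>b. b \<in> B \<Longrightarrow> S *v b = sqrt (b \<bullet> (A *v b)) *\<^sub>R b"
    using psd_diagonal[OF B, of "\<lambda>b. sqrt (b \<bullet> (A *v b))"] nonneg by auto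
  have "(S ** S) *v x = A *v x" for x
  proof (rule orthonormal_basis_eqI[OF B, of "(*v) (S ** S)" "(*v) A"])
    fix b assume b: "b \<in> B"
    have "(S ** S) *v b = (b \<bullet> (A *v b)) *\<^sub>R b"
      using S(2)[OF b] nonneg[of b]
      by (simp add: matrix_vector_mul_assoc[symmetric] matrix_vector_mult_scaleR)
    then show "(S ** S) *v b = A *v b" using eig[OF b] by simp
  qed simp_all
  then have SA: "S ** S = A" by (simp add: matrix_eq)
  have "S' = S" if "psd S' \<and> S' ** S' = A" for S'
  proof -
    have "S' *v x = S *v x" for x
    proof (rule orthonormal_basis_eqI[OF B, of "(*v) S'" "(*v) S"])
      fix b assume b: "b \<in> B"
      have "S' *v b = sqrt (b \<bullet> (A *v b)) *\<^sub>R b"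
        using that eig[OF b] nonneg[of b] by (intro psd_root_eigenvector) auto
      then show "S' *v b = S *v b" using S(2)[OF b] by simp
    qed simp_all
    then show ?thesis by (simp add: matrix_eq)
  qed
  with S(1) SA have "psd (msqrt A) \<and> msqrt A ** msqrt A = A"
    unfolding msqrt_def by (intro theI[of "\<lambda>S. psd S \<and> S ** S = A" S]) blast+
  then show "psd (msqrt A)" and "msqrt A ** msqrt A = A" by simp_all
qed

section \<open>Definite matrices and block matrices\<close>

lemma pd_imp_psd: "pd A \<Longrightarrow> psd A"
  unfolding pd_def psd_def
proof safe
  fix v assume "\<forall>v. v \<noteq> 0 \<longrightarrow> 0 < v \<bullet> (A *v v)"
  then show "0 \<le> v \<bullet> (A *v v)" by (cases "v = 0") (auto simp: less_imp_le)
qed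

lemma pd_inverse:
  fixes A :: "real^'n^'n"
  assumes "pd A"
  shows "A ** matrix_inv A = mat 1" and "matrix_inv A ** A = mat 1" and "pd (matrix_inv A)"
proof -
  have "inj ((*v) A)"
  proof (rule injI)
    fix x y assume "A *v x = A *v y"
    then have "(x - y) \<bullet> (A *v (x - y)) = 0"
      by (simp add: matrix_vector_mult_diff_distrib)
    then show "x = y" using assms unfolding pd_def by (metis less_irrefl right_minus_eq)
  qed
  then have "invertible A"
    by (simp add: invertible_left_inverse matrix_left_invertible_injective)
  then show inv: "A ** matrix_inv A = mat 1" "matrix_inv A ** A = mat 1"
    by (auto simp: invertible_def matrix_inv_def intro: someI2_ex)
  have sym: "transpose A = A" using assms by (simp add: pd_def)
  have "transpose (matrix_inv A) = transpose (matrix_inv A) ** (A ** matrix_inv A)"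
    by (simp add: inv)
  also have "\<dots> = transpose (A ** matrix_inv A) ** matrix_inv A"
    by (simp add: matrix_mul_assoc matrix_transpose_mul sym)
  finally have "transpose (matrix_inv A) = matrix_inv A" by (simp add: inv transpose_mat)
  moreover have "0 < v \<bullet> (matrix_inv A *v v)" if "v \<noteq> 0" for v
  proof -
    have v: "A *v (matrix_inv A *v v) = v" by (simp add: matrix_vector_mul_assoc inv)
    then have "matrix_inv A *v v \<noteq> 0" using that by (metis matrix_vector_mult_0_right)
    then have "0 < (matrix_inv A *v v) \<bullet> (A *v (matrix_inv A *v v))"
      using assms by (simp add: pd_def)
    then show ?thesis by (simp add: v inner_commute)
  qed
  ultimately show "pd (matrix_inv A)" by (simp add: pd_def)
qed

text \<open>This is applied with \<open>N = D\<close>, with \<open>N\<close> the inverse of \<open>D\<close> and with \<open>N = k I - C\<close>: it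
  yields the noncausal optimum and both Schur complements.\<close>

lemma complete_square:
  fixes N M :: "real^'n^'n"
  assumes "transpose N = N" and "N ** M = mat 1"
  shows "x \<bullet> (N *v x) + 2 * (x \<bullet> y) = (x + M *v y) \<bullet> (N *v (x + M *v y)) - y \<bullet> (M *v y)"
proof -
  have NM: "N *v (M *v y) = y" using assms(2) by (simp add: matrix_vector_mul_assoc)
  have "(M *v y) \<bullet> (N *v x) = x \<bullet> y"
    using inner_transpose[of N "M *v y" x] assms(1) NM by (simp add: inner_commute)
  then show ?thesis
    by (simp add: matrix_vector_right_distrib NM inner_simps inner_commute)
qed

definition vjoin :: "real^'a \<Rightarrow> real^'b \<Rightarrow> real^('a + 'b)" where
  "vjoin x y = (\<chi> i. case i of Inl a \<Rightarrow> x $ a | Inr b \<Rightarrow> y $ b)"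

lemma vjoin_nth [simp]: "vjoin x y $ Inl a = x $ a" "vjoin x y $ Inr b = y $ b"
  by (simp_all add: vjoin_def)

lemma sum_UNIV_plus:
  "(\<Sum>i\<in>(UNIV::('a::finite + 'b::finite) set). f i) = (\<Sum>a\<in>UNIV. f (Inl a)) + (\<Sum>b\<in>UNIV. f (Inr b))"
  by (subst UNIV_Plus_UNIV[symmetric], subst sum.Plus) simp_all

lemma vec_eq_plus_iff:
  "x = y \<longleftrightarrow> (\<forall>a. x $ Inl a = y $ Inl a) \<and> (\<forall>b. x $ Inr b = y $ Inr b)"
  unfolding vec_eq_iff by (metis sumE)

lemma all_vjoin: "(\<forall>v::real^('a::finite + 'b::finite). P v) \<longleftrightarrow> (\<forall>x y. P (vjoin x y))"
proof
  assume *: "\<forall>x y. P (vjoin x y)"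
  show "\<forall>v. P v"
  proof
    fix v :: "real^('a + 'b)"
    have "v = vjoin (\<chi> a. v $ Inl a) (\<chi> b. v $ Inr b)" by (simp add: vec_eq_plus_iff)
    then show "P v" using * by metis
  qed
qed simp

lemma vjoin_eq_0_iff [simp]: "vjoin x y = 0 \<longleftrightarrow> x = 0 \<and> y = 0"
  by (simp add: vec_eq_plus_iff) (simp add: vec_eq_iff)

lemma inner_vjoin [simp]: "vjoin x y \<bullet> vjoin x' y' = x \<bullet> x' + y \<bullet> y'"
  by (simp add: inner_vec_def sum_UNIV_plus)

lemma hcat_mult_vjoin [simp]: "hcat A B *v vjoin x y = A *v x + B *v y"
  by (simp add: vec_eq_iff matrix_vector_mult_def sum_UNIV_plus hcat_def)

lemma vcat_mult [simp]: "vcat A B *v x = vjoin (A *v x) (B *v x)"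
  by (simp add: vec_eq_plus_iff matrix_vector_mult_def vcat_def)

lemma transpose_hcat: "transpose (hcat A B) = vcat (transpose A) (transpose B)"
  by (simp add: vec_eq_plus_iff) (simp add: vec_eq_iff hcat_def vcat_def transpose_def)

lemma transpose_vcat: "transpose (vcat A B) = hcat (transpose A) (transpose B)"
  by (metis transpose_hcat transpose_transpose)

lemma vcat_hcat_swap: "vcat (hcat A B) (hcat C D) = hcat (vcat A C) (vcat B D)"
  by (simp add: vec_eq_plus_iff) (simp add: vec_eq_plus_iff hcat_def vcat_def)

lemma vcat_eq_iff: "vcat A B = vcat A' B' \<longleftrightarrow> A = A' \<and> B = B'"
  by (simp add: vec_eq_plus_iff) (simp add: vec_eq_iff vcat_def)

lemma hcat_eq_iff: "hcat A B = hcat A' B' \<longleftrightarrow> A = A' \<and> B = B'"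
  by (metis transpose_hcat transpose_transpose vcat_eq_iff)

lemma transpose_block:
  "transpose (vcat (hcat A (transpose B)) (hcat B C)) = vcat (hcat A (transpose B)) (hcat B C)
    \<longleftrightarrow> transpose A = A \<and> transpose C = C"
  by (subst vcat_hcat_swap) (simp add: transpose_hcat transpose_vcat vcat_eq_iff hcat_eq_iff)

lemma block_form:
  fixes B :: "real^'a^'b"
  shows "vjoin x y \<bullet> (vcat (hcat A (transpose B)) (hcat B C) *v vjoin x y) =
    x \<bullet> (A *v x) + 2 * (y \<bullet> (B *v x)) + y \<bullet> (C *v y)"
  using inner_transpose[of B y x]
  by (simp add: inner_add_right inner_commute[of x] del: transpose_matrix_vector)

text \<open>Spelling the upper right block as \<open>transpose B\<close> builds part of the symmetry into the pattern;
  both block constraints of the program have this shape.\<close>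

lemma psd_block:
  "psd (vcat (hcat A (transpose B)) (hcat B C)) \<longleftrightarrow>
    transpose A = A \<and> transpose C = C \<and>
    (\<forall>x y. 0 \<le> x \<bullet> (A *v x) + 2 * (y \<bullet> (B *v x)) + y \<bullet> (C *v y))"
  unfolding psd_def transpose_block all_vjoin[where P = "\<lambda>v. 0 \<le> v \<bullet> (M *v v)" for M]
    block_form by blast

lemma pd_block:
  "pd (vcat (hcat A (transpose B)) (hcat B C)) \<longleftrightarrow>
    transpose A = A \<and> transpose C = C \<and>
    (\<forall>x y. x \<noteq> 0 \<or> y \<noteq> 0 \<longrightarrow> 0 < x \<bullet> (A *v x) + 2 * (y \<bullet> (B *v x)) + y \<bullet> (C *v y))"
  unfolding pd_def transpose_block
    all_vjoin[where P = "\<lambda>v. v \<noteq> 0 \<longrightarrow> 0 < v \<bullet> (M *v v)" for M]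
    block_form vjoin_eq_0_iff by blast

section \<open>Schur complements of the two constraints\<close>

lemma mat_mult_vec: "mat k *v x = k *\<^sub>R (x :: real^'n)"
  by (simp add: vec_eq_iff matrix_vector_mult_def mat_def if_distrib[of "\<lambda>u. u * _"] cong: if_cong)

lemma weighted_gram_form: "x \<bullet> ((transpose L ** D ** L) *v x) = (L *v x) \<bullet> (D *v (L *v x))"
  for L :: "real^'n^'m"
  using inner_transpose[of L "D *v (L *v x)" x]
  by (simp only: matrix_vector_mul_assoc[symmetric] inner_commute[of x] inner_commute[of "L *v x"])

lemma transpose_weighted_gram:
  "transpose D = D \<Longrightarrow> transpose (transpose L ** D ** L) = transpose L ** D ** L"
  for D :: "real^'m^'m"
  by (simp add: matrix_transpose_mul matrix_mul_assoc)

lemma transpose_add: "transpose (A + B) = transpose A + transpose B" for A B :: "real^'n^'m"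
  by (simp add: vec_eq_iff transpose_def)

lemma transpose_diff: "transpose (A - B) = transpose A - transpose B" for A B :: "real^'n^'m"
  by (simp add: vec_eq_iff transpose_def)

text \<open>The second summand on the right vanishes at \<open>y = - D L x\<close>, so minimising the block form
  over \<open>y\<close> leaves the form of \<open>k I - L\<^sup>T D L\<close>.\<close>

lemma lower_square:
  fixes L :: "real^'n^'m"
  assumes "pd D"
  shows "k * (x \<bullet> x) + 2 * (y \<bullet> (L *v x)) + y \<bullet> (matrix_inv D *v y) =
    x \<bullet> ((mat k - transpose L ** D ** L) *v x) +
    (y + D *v (L *v x)) \<bullet> (matrix_inv D *v (y + D *v (L *v x)))"
proof -
  have "y \<bullet> (matrix_inv D *v y) + 2 * (y \<bullet> (L *v x)) =
    (y + D *v (L *v x)) \<bullet> (matrix_inv D *v (y + D *v (L *v x))) - (L *v x) \<bullet> (D *v (L *v x))"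
    using pd_inverse[OF assms] by (intro complete_square) (auto simp: pd_def)
  then show ?thesis
    by (simp add: matrix_vector_mult_diff_rdistrib inner_diff_right weighted_gram_form mat_mult_vec)
qed

text \<open>Read off from the previous identity, with the minimiser \<open>y = - D L x\<close> as test vector in one
  direction.\<close>

lemma schur_definite:
  fixes L :: "real^'n^'m"
  assumes D: "pd D"
  shows "pd (vcat (hcat (mat k) (transpose L)) (hcat L (matrix_inv D))) \<longleftrightarrow>
    pd (mat k - transpose L ** D ** L)"
proof -
  let ?E = "mat k - transpose L ** D ** L" and ?Di = "matrix_inv D"
  have Di: "pd ?Di" and symD: "transpose D = D"
    using D pd_inverse(3)[OF D] by (simp_all add: pd_def)
  have symE: "transpose ?E = ?E"
    by (simp add: transpose_diff transpose_mat transpose_weighted_gram symD)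
  have form: "x \<bullet> (mat k *v x) + 2 * (y \<bullet> (L *v x)) + y \<bullet> (?Di *v y) =
    x \<bullet> (?E *v x) + (y + D *v (L *v x)) \<bullet> (?Di *v (y + D *v (L *v x)))" for x y
    using lower_square[OF D, of k x y L] by (simp add: mat_mult_vec)
  have Di0: "0 \<le> y \<bullet> (?Di *v y)" for y
    using pd_imp_psd[OF Di] by (simp add: psd_def)
  show ?thesis
  proof
    assume *: "pd (vcat (hcat (mat k) (transpose L)) (hcat L ?Di))"
    have "0 < x \<bullet> (?E *v x)" if "x \<noteq> 0" for x
    proof -
      have "0 < x \<bullet> (mat k *v x) + 2 * (- (D *v (L *v x)) \<bullet> (L *v x))
          + - (D *v (L *v x)) \<bullet> (?Di *v - (D *v (L *v x)))"
        using * that unfolding pd_block by blast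
      then show ?thesis unfolding form by simp
    qed
    then show "pd ?E" using symE by (simp add: pd_def)
  next
    assume E: "pd ?E"
    have "0 < x \<bullet> (?E *v x) + (y + D *v (L *v x)) \<bullet> (?Di *v (y + D *v (L *v x)))"
      if "x \<noteq> 0 \<or> y \<noteq> 0" for x y
    proof (cases "x = 0")
      case True
      then show ?thesis using that Di by (simp add: pd_def)
    next
      case False
      then have "0 < x \<bullet> (?E *v x)" using E by (simp add: pd_def)
      then show ?thesis using Di0 by (intro add_pos_nonneg)
    qed
    then show "pd (vcat (hcat (mat k) (transpose L)) (hcat L ?Di))"
      unfolding pd_block form using Di by (auto simp: transpose_mat pd_def)
  qed
qed

text \<open>The lower right block is positive definite, so its form can be minimised for fixed \<open>a\<close>. Two
  squares are completed in turn, first in \<open>c\<close> and then in \<open>b\<close>, which leaves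
  \<open>a \<bullet> X a - k\<^sup>2 (S a) \<bullet> (k I - C)\<^sup>-\<^sup>1 (S a)\<close> with \<open>C = L\<^sup>T D L\<close>.\<close>

lemma schur_semidefinite:
  fixes L :: "real^'n^'m" and S X :: "real^'n^'n"
  assumes D: "pd D" and S: "transpose S = S" and E: "pd (mat k - transpose L ** D ** L)"
  shows "psd (vcat (hcat X (hcat (k *\<^sub>R S) (transpose 0)))
            (vcat (hcat (k *\<^sub>R S) (hcat (mat k) (transpose L)))
                  (hcat (0 :: real^'n^'m) (hcat L (matrix_inv D))))) \<longleftrightarrow>
    transpose X = X \<and>
    (\<forall>a. k\<^sup>2 * ((S *v a) \<bullet> (matrix_inv (mat k - transpose L ** D ** L) *v (S *v a))) \<le> a \<bullet> (X *v a))"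
proof -
  let ?E = "mat k - transpose L ** D ** L" and ?Di = "matrix_inv D"
  let ?H = "matrix_inv ?E" and ?N = "vcat (hcat (mat k) (transpose L)) (hcat L ?Di)"
  let ?W = "vcat (k *\<^sub>R S) (0 :: real^'n^'m)"
  have Di: "pd ?Di" by (rule pd_inverse[OF D])
  have Di0: "0 \<le> y \<bullet> (?Di *v y)" for y
    using pd_imp_psd[OF Di] by (simp add: psd_def)
  have E0: "0 \<le> x \<bullet> (?E *v x)" for x
    using pd_imp_psd[OF E] by (simp add: psd_def)
  have symN: "transpose ?N = ?N"
    using E unfolding schur_definite[OF D, symmetric] by (simp add: pd_def)
  have square: "k * (b \<bullet> b) + 2 * (c \<bullet> (L *v b)) + c \<bullet> (?Di *v c) + 2 * (b \<bullet> (k *\<^sub>R S *v a)) =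
    (b + ?H *v (k *\<^sub>R S *v a)) \<bullet> (?E *v (b + ?H *v (k *\<^sub>R S *v a)))
    + (c + D *v (L *v b)) \<bullet> (?Di *v (c + D *v (L *v b)))
    - k\<^sup>2 * ((S *v a) \<bullet> (?H *v (S *v a)))" for a b c
  proof -
    have "b \<bullet> (?E *v b) + 2 * (b \<bullet> (k *\<^sub>R S *v a)) =
      (b + ?H *v (k *\<^sub>R S *v a)) \<bullet> (?E *v (b + ?H *v (k *\<^sub>R S *v a)))
      - (k *\<^sub>R S *v a) \<bullet> (?H *v (k *\<^sub>R S *v a))"
      using pd_inverse[OF E] E by (intro complete_square) (auto simp: pd_def)
    moreover have "(k *\<^sub>R S *v a) \<bullet> (?H *v (k *\<^sub>R S *v a)) = k\<^sup>2 * ((S *v a) \<bullet> (?H *v (S *v a)))"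
      by (simp add: scaleR_matrix_vector_assoc[symmetric] matrix_vector_mult_scaleR power2_eq_square)
    ultimately show ?thesis using lower_square[OF D, of k b c L] by linarith
  qed
  \<comment> \<open>The three by three block matrix, regarded as two by two with first block \<open>X\<close>.\<close>
  have eq: "vcat (hcat X (hcat (k *\<^sub>R S) (transpose 0)))
            (vcat (hcat (k *\<^sub>R S) (hcat (mat k) (transpose L))) (hcat 0 (hcat L ?Di)))
      = vcat (hcat X (transpose ?W)) (hcat ?W ?N)"
    using S by (simp add: transpose_vcat transpose_scalar vcat_hcat_swap[of "k *\<^sub>R S"])
  have form: "a \<bullet> (X *v a) + 2 * (vjoin b c \<bullet> (?W *v a)) + vjoin b c \<bullet> (?N *v vjoin b c) =
      a \<bullet> (X *v a) - k\<^sup>2 * ((S *v a) \<bullet> (?H *v (S *v a)))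
      + (b + ?H *v (k *\<^sub>R S *v a)) \<bullet> (?E *v (b + ?H *v (k *\<^sub>R S *v a)))
      + (c + D *v (L *v b)) \<bullet> (?Di *v (c + D *v (L *v b)))" for a b c
    using square[of b c a] unfolding block_form by (simp add: mat_mult_vec)
  show ?thesis
    unfolding eq psd_block
  proof (intro conj_cong refl iffI)
    assume *: "transpose ?N = ?N \<and>
      (\<forall>a y. 0 \<le> a \<bullet> (X *v a) + 2 * (y \<bullet> (?W *v a)) + y \<bullet> (?N *v y))"
    show "\<forall>a. k\<^sup>2 * ((S *v a) \<bullet> (?H *v (S *v a))) \<le> a \<bullet> (X *v a)"
    proof
      fix a
      \<comment> \<open>The point at which both completed squares vanish.\<close>
      define b where "b = - (?H *v (k *\<^sub>R S *v a))"
      define c where "c = - (D *v (L *v b))"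
      have "b + ?H *v (k *\<^sub>R S *v a) = 0" "c + D *v (L *v b) = 0" by (simp_all add: b_def c_def)
      moreover have "0 \<le> a \<bullet> (X *v a) + 2 * (vjoin b c \<bullet> (?W *v a)) + vjoin b c \<bullet> (?N *v vjoin b c)"
        using * by blast
      ultimately show "k\<^sup>2 * ((S *v a) \<bullet> (?H *v (S *v a))) \<le> a \<bullet> (X *v a)"
        unfolding form by simp
    qed
  next
    assume *: "\<forall>a. k\<^sup>2 * ((S *v a) \<bullet> (?H *v (S *v a))) \<le> a \<bullet> (X *v a)"
    have "0 \<le> a \<bullet> (X *v a) + 2 * (y \<bullet> (?W *v a)) + y \<bullet> (?N *v y)" for a y
    proof -
      have "\<forall>y. 0 \<le> a \<bullet> (X *v a) + 2 * (y \<bullet> (?W *v a)) + y \<bullet> (?N *v y)"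
      proof (subst all_vjoin, intro allI)
        fix b c
        show "0 \<le> a \<bullet> (X *v a) + 2 * (vjoin b c \<bullet> (?W *v a)) + vjoin b c \<bullet> (?N *v vjoin b c)"
          unfolding form using * Di0 E0 by (intro add_nonneg_nonneg) auto
      qed
      then show ?thesis by blast
    qed
    with symN show "transpose ?N = ?N \<and>
      (\<forall>a y. 0 \<le> a \<bullet> (X *v a) + 2 * (y \<bullet> (?W *v a)) + y \<bullet> (?N *v y))" by blast
  qed
qed

section \<open>The program in an eigenbasis\<close>

lemma eigenbasis_form:
  fixes C :: "real^'n^'n"
  assumes B: "orthonormal_basis B" and eig: "\<And>b. b \<in> B \<Longrightarrow> C *v b = c b *\<^sub>R b"
    and sym: "transpose C = C"
  shows "x \<bullet> (C *v y) = (\<Sum>b\<in>B. c b * (x \<bullet> b) * (y \<bullet> b))"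
proof -
  have "(C *v y) \<bullet> b = c b * (y \<bullet> b)" if "b \<in> B" for b
    using inner_transpose[of C y b] eig[OF that] sym by simp
  then show ?thesis
    by (subst orthonormal_basis_parseval[OF B]) (simp add: mult_ac)
qed

lemma pd_shift_iff:
  fixes C :: "real^'n^'n"
  assumes B: "orthonormal_basis B" and eig: "\<And>b. b \<in> B \<Longrightarrow> C *v b = c b *\<^sub>R b"
    and sym: "transpose C = C"
  shows "pd (mat k - C) \<longleftrightarrow> (\<forall>b\<in>B. c b < k)"
proof
  assume pd: "pd (mat k - C)"
  show "\<forall>b\<in>B. c b < k"
  proof
    fix b assume b: "b \<in> B"
    then have "b \<bullet> b = 1" using B by (simp add: orthonormal_basis_def dot_square_norm)
    moreover from this have "b \<noteq> 0" by auto
    then have "0 < b \<bullet> ((mat k - C) *v b)" using pd by (simp add: pd_def)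
    ultimately show "c b < k"
      by (simp add: matrix_vector_mult_diff_rdistrib mat_mult_vec eig[OF b] inner_diff_right)
  qed
next
  assume k: "\<forall>b\<in>B. c b < k"
  have "0 < x \<bullet> ((mat k - C) *v x)" if "x \<noteq> 0" for x
  proof -
    have "x \<bullet> ((mat k - C) *v x) = k * (x \<bullet> x) - x \<bullet> (C *v x)"
      by (simp add: matrix_vector_mult_diff_rdistrib mat_mult_vec inner_diff_right)
    also have "\<dots> = k * (\<Sum>b\<in>B. (x \<bullet> b) * (x \<bullet> b)) - (\<Sum>b\<in>B. c b * (x \<bullet> b) * (x \<bullet> b))"
      by (simp only: eigenbasis_form[OF assms, of x x]
          orthonormal_basis_parseval[OF B, of x x])
    also have "\<dots> = (\<Sum>b\<in>B. (k - c b) * (x \<bullet> b)\<^sup>2)"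
      by (simp add: sum_distrib_left sum_subtractf[symmetric] power2_eq_square left_diff_distrib
          mult.assoc)
    finally have form: "x \<bullet> ((mat k - C) *v x) = (\<Sum>b\<in>B. (k - c b) * (x \<bullet> b)\<^sup>2)" .
    have "(\<Sum>b\<in>B. (x \<bullet> b) *\<^sub>R b) \<noteq> 0" using that orthonormal_basis_expansion[OF B] by simp
    then obtain b where "b \<in> B" "(x \<bullet> b) *\<^sub>R b \<noteq> 0"
      by (rule sum.not_neutral_contains_not_neutral)
    then have "b \<in> B" "x \<bullet> b \<noteq> 0" by auto
    then show ?thesis unfolding form using k B
      by (intro sum_pos2[of _ b]) (auto simp: orthonormal_basis_def less_imp_le)
  qed
  then show "pd (mat k - C)" using sym by (simp add: pd_def transpose_diff transpose_mat)
qed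

lemma shift_inverse_eigenvector:
  fixes C :: "real^'n^'n"
  assumes pd: "pd (mat k - C)" and eig: "C *v b = l *\<^sub>R b" and l: "l < k"
  shows "matrix_inv (mat k - C) *v b = (1 / (k - l)) *\<^sub>R b"
proof -
  have "(mat k - C) *v ((1 / (k - l)) *\<^sub>R b) = b"
    using l by (simp add: matrix_vector_mult_scaleR matrix_vector_mult_diff_rdistrib mat_mult_vec
        eig scaleR_diff_left[symmetric] del: scaleR_diff_left)
  then have "matrix_inv (mat k - C) *v b =
      (matrix_inv (mat k - C) ** (mat k - C)) *v ((1 / (k - l)) *\<^sub>R b)"
    by (simp only: matrix_vector_mul_assoc[symmetric])
  then show ?thesis by (simp add: pd_inverse(2)[OF pd])
qed

text \<open>The Lagrangian dual function of maximising \<open>\<Sum>b. c b * E (z \<bullet> b)\<^sup>2\<close> over a Wasserstein ball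
  of radius \<open>r\<close> whose centre has second moment \<open>m b\<close> in direction \<open>b\<close>. The multiplier of the
  transport budget is \<open>k\<close>; each summand is the value of the scalar problem
  \<open>sup z. c z\<^sup>2 - k (z - w)\<^sup>2 = k c / (k - c) * w\<^sup>2\<close>, averaged over \<open>w\<close>.\<close>

definition dual_value ::
    "'a::euclidean_space set \<Rightarrow> ('a \<Rightarrow> real) \<Rightarrow> ('a \<Rightarrow> real) \<Rightarrow> real \<Rightarrow> real \<Rightarrow> real" where
  "dual_value B m c r k = k * r\<^sup>2 + (\<Sum>b\<in>B. m b * (k * c b / (k - c b)))"

lemma psd_trace_mono:
  fixes X Y :: "real^'n^'n" and B :: "(real^'n) set"
  assumes B: "orthonormal_basis B" and "\<And>a. a \<bullet> (X *v a) \<le> a \<bullet> (Y *v a)"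
  shows "trace X \<le> trace Y"
  unfolding trace_orthonormal_basis[OF B] using assms(2) by (intro sum_mono)

text \<open>For fixed \<open>k\<close> the constraint says \<open>X \<ge> X0\<close> with \<open>X0 = k\<^sup>2 S H S\<close>, where \<open>S\<close> is the root of
  \<open>M\<close> and \<open>H\<close> the inverse of \<open>k I - C\<close>. The trace is monotone, so \<open>X0\<close> is optimal, and cyclicity
  turns its trace into \<open>k\<^sup>2 Tr (H M)\<close>, which is diagonal in the eigenbasis.\<close>

lemma sdp_minimum_over_X:
  fixes L :: "real^'n^'m" and M :: "real^'n^'n" and D :: "real^'m^'m" and B :: "(real^'n) set"
  defines "C \<equiv> transpose L ** D ** L"
  defines "constr X k \<equiv> vcat (hcat X (hcat (k *\<^sub>R msqrt M) (transpose 0)))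
            (vcat (hcat (k *\<^sub>R msqrt M) (hcat (mat k) (transpose L)))
                  (hcat (0 :: real^'n^'m) (hcat L (matrix_inv D))))"
  assumes D: "pd D" and M: "psd M" and B: "orthonormal_basis B"
    and eig: "\<And>b. b \<in> B \<Longrightarrow> C *v b = c b *\<^sub>R b" and k: "\<And>b. b \<in> B \<Longrightarrow> c b < k"
  shows "psd (constr X k) \<Longrightarrow> dual_value B (\<lambda>b. b \<bullet> (M *v b)) c r k \<le> sdp_objective M r k X"
    and "\<exists>X. psd X \<and> psd (constr X k) \<and>
           sdp_objective M r k X = dual_value B (\<lambda>b. b \<bullet> (M *v b)) c r k"
proof -
  define S H where "S = msqrt M" and "H = matrix_inv (mat k - C)"
  have SS: "S ** S = M" and symS: "transpose S = S"
    using msqrt[OF M] by (auto simp: S_def psd_def)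
  have "transpose C = C" using D by (simp add: C_def transpose_weighted_gram pd_def)
  then have E: "pd (mat k - C)" using pd_shift_iff[OF B eig] k by simp
  have H: "pd H" unfolding H_def by (rule pd_inverse(3)[OF E])
  have Hb: "H *v b = (1 / (k - c b)) *\<^sub>R b" if "b \<in> B" for b
    unfolding H_def using E eig[OF that] k[OF that] by (rule shift_inverse_eigenvector)
  define X0 where "X0 = k\<^sup>2 *\<^sub>R (S ** H ** S)"
  have X0: "a \<bullet> (X0 *v a) = k\<^sup>2 * ((S *v a) \<bullet> (H *v (S *v a)))" for a
    using weighted_gram_form[of a S H] symS
    by (simp add: X0_def scaleR_matrix_vector_assoc[symmetric])
  have symX0: "transpose X0 = X0"
    using transpose_weighted_gram[of H S] symS H by (simp add: X0_def transpose_scalar pd_def)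
  have "0 \<le> a \<bullet> (X0 *v a)" for a
    unfolding X0 using pd_imp_psd[OF H] by (simp add: psd_def)
  then have psdX0: "psd X0" using symX0 by (simp add: psd_def)
  have constr: "psd (constr X k) \<longleftrightarrow>
      transpose X = X \<and> (\<forall>a. a \<bullet> (X0 *v a) \<le> a \<bullet> (X *v a))" for X
    using schur_semidefinite[OF D symS, of k L X] E
    unfolding constr_def X0 H_def C_def S_def by blast
  have "trace (S ** H ** S) = trace (H ** M)"
    using trace_mul_sym[of S "H ** S"] by (simp add: matrix_mul_assoc[symmetric] SS)
  also have "\<dots> = (\<Sum>b\<in>B. (b \<bullet> (M *v b)) / (k - c b))"
    unfolding trace_orthonormal_basis[OF B]
  proof (rule sum.cong[OF refl])
    fix b assume b: "b \<in> B"
    have "b \<bullet> ((H ** M) *v b) = (H *v b) \<bullet> (M *v b)"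
      using inner_transpose[of H b "M *v b"] H
      by (simp add: pd_def matrix_vector_mul_assoc[symmetric] del: transpose_matrix_vector)
    then show "b \<bullet> ((H ** M) *v b) = (b \<bullet> (M *v b)) / (k - c b)" by (simp add: Hb[OF b])
  qed
  finally have tr: "trace (S ** H ** S) = (\<Sum>b\<in>B. (b \<bullet> (M *v b)) / (k - c b))" .
  have "trace X0 = k\<^sup>2 * trace (S ** H ** S)"
    by (simp add: X0_def trace_def sum_distrib_left)
  then have trX0: "trace X0 = k\<^sup>2 * (\<Sum>b\<in>B. (b \<bullet> (M *v b)) / (k - c b))"
    by (simp only: tr)
  have "sdp_objective M r k X0 = k * r\<^sup>2 +
      (\<Sum>b\<in>B. k\<^sup>2 * ((b \<bullet> (M *v b)) / (k - c b)) - k * (b \<bullet> (M *v b)))"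
    by (simp add: sdp_objective_def trX0 trace_orthonormal_basis[OF B, of M] sum_subtractf
        sum_distrib_left algebra_simps)
  also have "\<dots> = dual_value B (\<lambda>b. b \<bullet> (M *v b)) c r k"
  proof -
    have "k\<^sup>2 * (m / (k - c b)) - k * m = m * (k * c b / (k - c b))" if "b \<in> B" for b m
      using k[OF that] by (simp add: field_simps power2_eq_square)
    then show ?thesis by (simp add: dual_value_def)
  qed
  finally have obj: "sdp_objective M r k X0 = dual_value B (\<lambda>b. b \<bullet> (M *v b)) c r k" .
  show "\<exists>X. psd X \<and> psd (constr X k) \<and>
      sdp_objective M r k X = dual_value B (\<lambda>b. b \<bullet> (M *v b)) c r k"
    using psdX0 obj by (intro exI[of _ X0]) (simp add: constr symX0)
  assume "psd (constr X k)"
  then have "trace X0 \<le> trace X" using constr by (intro psd_trace_mono[OF B]) blast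
  then show "dual_value B (\<lambda>b. b \<bullet> (M *v b)) c r k \<le> sdp_objective M r k X"
    unfolding obj[symmetric] by (simp add: sdp_objective_def)
qed

section \<open>Second moments and couplings\<close>

lemma prob2_integrable_inner:
  assumes "P \<in> prob2"
  shows "integrable P (\<lambda>z. (z \<bullet> a) * (z \<bullet> b))"
proof (rule Bochner_Integration.integrable_bound[of P "\<lambda>z. norm a * norm b * (norm z)\<^sup>2"])
  have sets: "sets P = sets borel" using assms by (simp add: prob2_def)
  show "(\<lambda>z. (z \<bullet> a) * (z \<bullet> b)) \<in> borel_measurable P"
    unfolding measurable_cong_sets[OF sets refl] by measurable
  show "AE z in P. norm ((z \<bullet> a) * (z \<bullet> b)) \<le> norm (norm a * norm b * (norm z)\<^sup>2)"
  proof (rule AE_I2)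
    fix z
    have "\<bar>z \<bullet> a\<bar> * \<bar>z \<bullet> b\<bar> \<le> (norm z * norm a) * (norm z * norm b)"
      by (intro mult_mono Cauchy_Schwarz_ineq2) auto
    then show "norm ((z \<bullet> a) * (z \<bullet> b)) \<le> norm (norm a * norm b * (norm z)\<^sup>2)"
      by (simp add: abs_mult power2_eq_square mult_ac)
  qed
qed (use assms in \<open>simp add: prob2_def\<close>)

lemma prob2_integrable_inner_square:
  "P \<in> prob2 \<Longrightarrow> integrable P (\<lambda>z. (z \<bullet> a)\<^sup>2)"
  using prob2_integrable_inner[of P a a] by (simp add: power2_eq_square)

lemma second_moment_form:
  fixes P :: "(real^'n) measure"
  assumes "P \<in> prob2"
  shows "v \<bullet> (second_moment P *v v) = (\<integral>z. (z \<bullet> v)\<^sup>2 \<partial>P)"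
proof -
  have int: "integrable P (\<lambda>z. z $ i * z $ j)" for i j
    using prob2_integrable_inner[OF assms, of "axis i 1" "axis j 1"] by (simp add: inner_axis)
  have "(z \<bullet> v)\<^sup>2 = (\<Sum>i\<in>UNIV. \<Sum>j\<in>UNIV. v $ i * v $ j * (z $ i * z $ j))" for z
    by (simp add: inner_vec_def power2_eq_square sum_product mult_ac)
  then have "(\<integral>z. (z \<bullet> v)\<^sup>2 \<partial>P) =
      (\<Sum>i\<in>UNIV. \<Sum>j\<in>UNIV. v $ i * v $ j * (\<integral>z. z $ i * z $ j \<partial>P))"
    by (simp add: int)
  then show ?thesis
    by (simp add: inner_vec_def matrix_vector_mult_def second_moment_def sum_distrib_left mult_ac)
qed

lemma psd_second_moment:
  fixes P :: "(real^'n) measure"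
  assumes "P \<in> prob2"
  shows "psd (second_moment P)"
proof -
  have "transpose (second_moment P) = second_moment P"
    by (simp add: second_moment_def transpose_def vec_eq_iff mult.commute)
  then show ?thesis by (simp add: psd_def second_moment_form[OF assms])
qed

text \<open>This is where absolute continuity enters: a zero second moment in direction \<open>b\<close> would
  concentrate the measure on the hyperplane orthogonal to \<open>b\<close>, a Lebesgue null set.\<close>

lemma directional_second_moment_pos:
  fixes P :: "'a::euclidean_space measure"
  assumes P: "P \<in> prob2" and ac: "absolutely_continuous lborel P" and b: "b \<noteq> 0"
  shows "0 < (\<integral>z. (z \<bullet> b)\<^sup>2 \<partial>P)"
proof -
  have sets: "sets P = sets borel" and "prob_space P" using P by (auto simp: prob2_def)
  interpret prob_space P by fact
  let ?Z = "{z. b \<bullet> z = 0}"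
  have meas: "?Z \<in> sets borel" by (intro borel_closed closed_hyperplane)
  have "?Z \<in> null_sets lborel"
    using negligible_hyperplane[of b 0] b meas
    by (auto simp: negligible_iff_null_sets null_sets_completion_iff)
  then have null: "?Z \<in> null_sets P" using ac by (auto simp: absolutely_continuous_def)
  have "(\<integral>z. (z \<bullet> b)\<^sup>2 \<partial>P) \<noteq> 0"
  proof
    assume "(\<integral>z. (z \<bullet> b)\<^sup>2 \<partial>P) = 0"
    then have "AE z in P. (z \<bullet> b)\<^sup>2 = 0"
      using integral_nonneg_eq_0_iff_AE[OF prob2_integrable_inner_square[OF P]] by simp
    then have "AE z in P. z \<in> ?Z" by (simp add: inner_commute)
    then have "AE z in P. False" using AE_not_in[OF null] by eventually_elim simp
    then show False by simp
  qed
  then show ?thesis by (simp add: integral_nonneg order.not_eq_order_implies_strict)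
qed

lemma norm_Pair_square: "(norm z)\<^sup>2 = (norm (fst z))\<^sup>2 + (norm (snd z))\<^sup>2"
  for z :: "'a::euclidean_space \<times> 'a"
  by (simp add: norm_prod_def)

lemma couplingsD:
  fixes \<pi> :: "('a::euclidean_space \<times> 'a) measure" and f :: "'a \<Rightarrow> real"
  assumes "\<pi> \<in> couplings P1 P2" and "f \<in> borel_measurable borel"
  shows "integrable P1 f \<longleftrightarrow> integrable \<pi> (\<lambda>z. f (fst z))"
    and "integrable P2 f \<longleftrightarrow> integrable \<pi> (\<lambda>z. f (snd z))"
    and "(\<integral>z. f z \<partial>P1) = (\<integral>z. f (fst z) \<partial>\<pi>)"
    and "(\<integral>z. f z \<partial>P2) = (\<integral>z. f (snd z) \<partial>\<pi>)"
proof -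
  have sets: "sets \<pi> = sets borel"
    and marg: "P1 = distr \<pi> borel fst" "P2 = distr \<pi> borel snd"
    using assms(1) by (auto simp: couplings_def prob2_def)
  have meas: "fst \<in> measurable \<pi> borel" "snd \<in> measurable \<pi> borel"
    unfolding measurable_cong_sets[OF sets refl] borel_prod[symmetric] by measurable
  show "integrable P1 f \<longleftrightarrow> integrable \<pi> (\<lambda>z. f (fst z))"
    "integrable P2 f \<longleftrightarrow> integrable \<pi> (\<lambda>z. f (snd z))"
    "(\<integral>z. f z \<partial>P1) = (\<integral>z. f (fst z) \<partial>\<pi>)" "(\<integral>z. f z \<partial>P2) = (\<integral>z. f (snd z) \<partial>\<pi>)"
    unfolding marg
    by (fact integrable_distr_eq[OF meas(1) assms(2)] integrable_distr_eq[OF meas(2) assms(2)]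
        integral_distr[OF meas(1) assms(2)] integral_distr[OF meas(2) assms(2)])+
qed

text \<open>The product measure. Without a coupling the infimum in \<^const>\<open>wasserstein2\<close> would be an
  unspecified real number.\<close>

lemma couplings_nonempty:
  fixes P1 P2 :: "'a::euclidean_space measure"
  assumes "P1 \<in> prob2" and "P2 \<in> prob2"
  shows "couplings P1 P2 \<noteq> {}"
proof -
  let ?p = "P1 \<Otimes>\<^sub>M P2"
  have sets1: "sets P1 = sets borel" and sets2: "sets P2 = sets borel"
    and "prob_space P1" and "prob_space P2"
    using assms by (auto simp: prob2_def)
  interpret p1: prob_space P1 by fact
  interpret p2: prob_space P2 by fact
  interpret pp: pair_prob_space P1 P2 ..
  have sets: "sets ?p = sets borel"
    using sets_pair_measure_cong[OF sets1 sets2] unfolding borel_prod .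
  have meas: "fst \<in> measurable ?p borel" "snd \<in> measurable ?p borel"
    unfolding measurable_cong_sets[OF sets refl] borel_prod[symmetric] by measurable
  have sp: "space P1 = UNIV" "space P2 = UNIV" "space ?p = UNIV"
    using sets_eq_imp_space_eq[OF sets1] sets_eq_imp_space_eq[OF sets2]
    by (simp_all add: space_pair_measure)
  have fst: "distr ?p borel fst = P1"
  proof (rule measure_eqI)
    fix S assume "S \<in> sets (distr ?p borel fst)"
    then have S: "S \<in> sets borel" by simp
    have "fst -` S = S \<times> (UNIV :: 'a set)" by auto
    then show "emeasure (distr ?p borel fst) S = emeasure P1 S"
      using S meas sets1 p2.emeasure_pair_measure_Times[of S P1 UNIV] p2.emeasure_space_1 sp
        sets.top[of P2] by (simp add: emeasure_distr)
  qed (simp add: sets1)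
  have snd: "distr ?p borel snd = P2"
  proof (rule measure_eqI)
    fix S assume "S \<in> sets (distr ?p borel snd)"
    then have S: "S \<in> sets borel" by simp
    have "snd -` S = (UNIV :: 'a set) \<times> S" by auto
    then show "emeasure (distr ?p borel snd) S = emeasure P2 S"
      using S meas sets2 p2.emeasure_pair_measure_Times[of UNIV P1 S] p1.emeasure_space_1 sp
        sets.top[of P1] by (simp add: emeasure_distr)
  qed (simp add: sets2)
  have "integrable (distr ?p borel fst) (\<lambda>z. (norm z)\<^sup>2)"
    "integrable (distr ?p borel snd) (\<lambda>z. (norm z)\<^sup>2)"
    unfolding fst snd using assms by (simp_all add: prob2_def)
  then have "integrable ?p (\<lambda>z. (norm z)\<^sup>2)"
    unfolding norm_Pair_square using meas by (simp add: integrable_distr_eq)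
  then have "?p \<in> couplings P1 P2"
    using fst snd sets pp.prob_space_axioms by (simp add: couplings_def prob2_def)
  then show ?thesis by blast
qed

text \<open>A transport map gives the coupling concentrated on its graph.\<close>

lemma pushforward_in_ambiguity:
  fixes P0 :: "'a::euclidean_space measure"
  assumes P0: "P0 \<in> prob2" and T: "T \<in> borel_measurable borel"
    and int: "integrable P0 (\<lambda>w. (norm (T w))\<^sup>2)" and r: "0 \<le> r"
    and cost: "(\<integral>w. (norm (T w - w))\<^sup>2 \<partial>P0) \<le> r\<^sup>2"
  shows "distr P0 borel T \<in> ambiguity P0 r"
proof -
  have sets: "sets P0 = sets borel" and "prob_space P0"
    and int0: "integrable P0 (\<lambda>w. (norm w)\<^sup>2)" using P0 by (auto simp: prob2_def)
  interpret prob_space P0 by fact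
  have T0: "T \<in> measurable P0 borel" using T by (simp add: measurable_cong_sets[OF sets refl])
  define \<pi> where "\<pi> = distr P0 borel (\<lambda>w. (T w, w))"
  have graph: "(\<lambda>w. (T w, w)) \<in> measurable P0 borel"
    unfolding measurable_cong_sets[OF sets refl] borel_prod[symmetric] using T by measurable
  have proj: "(fst :: 'a \<times> 'a \<Rightarrow> 'a) \<in> measurable borel borel"
    "(snd :: 'a \<times> 'a \<Rightarrow> 'a) \<in> measurable borel borel"
    unfolding borel_prod[symmetric] by measurable
  have prob2: "distr P0 borel T \<in> prob2"
    using int T0 by (simp add: prob2_def prob_space_distr integrable_distr_eq)
  have "\<pi> \<in> couplings (distr P0 borel T) P0"
  proof -
    have "distr \<pi> borel fst = distr P0 borel T" "distr \<pi> borel snd = distr P0 borel (\<lambda>w. w)"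
      unfolding \<pi>_def using graph proj by (simp_all add: distr_distr comp_def)
    moreover have "distr P0 borel (\<lambda>w. w) = P0"
      using distr_id2[of borel P0] sets by simp
    moreover have "integrable \<pi> (\<lambda>z. (norm z)\<^sup>2)"
      unfolding \<pi>_def norm_Pair_square using graph int int0 proj
      by (subst integrable_distr_eq) auto
    ultimately show ?thesis
      using graph by (simp add: couplings_def prob2_def \<pi>_def prob_space_distr)
  qed
  then have "(INF \<pi>\<in>couplings (distr P0 borel T) P0. \<integral>z. (norm (fst z - snd z))\<^sup>2 \<partial>\<pi>)
      \<le> (\<integral>z. (norm (fst z - snd z))\<^sup>2 \<partial>\<pi>)"
    by (intro cINF_lower bdd_belowI2[of _ 0]) (simp_all add: integral_nonneg)
  also have "\<dots> = (\<integral>w. (norm (T w - w))\<^sup>2 \<partial>P0)"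
    unfolding \<pi>_def using graph proj by (subst integral_distr) auto
  finally have "wasserstein2 (distr P0 borel T) P0 \<le> r"
    unfolding wasserstein2_def using cost r by (intro real_le_lsqrt) auto
  with prob2 show ?thesis by (simp add: ambiguity_def)
qed

section \<open>The worst-case second moment over a Wasserstein ball\<close>

lemma inner_orthonormal_sum:
  assumes "orthonormal_basis B" and "e \<in> B"
  shows "(\<Sum>b\<in>B. f b *\<^sub>R b) \<bullet> e = f e"
proof -
  have "f b * (b \<bullet> e) = (if b = e then f e else 0)" if "b \<in> B" for b
    using assms that
    by (auto simp: orthonormal_basis_def pairwise_def orthogonal_def dot_square_norm)
  then have "(\<Sum>b\<in>B. f b *\<^sub>R b) \<bullet> e = (\<Sum>b\<in>B. if b = e then f e else 0)"
    by (simp add: inner_sum_left cong: sum.cong)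
  then show ?thesis using assms by (simp add: orthonormal_basis_def)
qed

lemma norm_square_orthonormal:
  "orthonormal_basis B \<Longrightarrow> (norm x)\<^sup>2 = (\<Sum>b\<in>B. (x \<bullet> b)\<^sup>2)"
  using orthonormal_basis_parseval[of B x x] by (simp only: power2_norm_eq_inner power2_eq_square[of "_ \<bullet> _"])

text \<open>The gap is the square of \<open>(k - c) z - k w\<close> over \<open>k - c\<close>, so equality holds at
  \<open>z = k / (k - c) * w\<close>: this is the worst-case displacement of the mass at \<open>w\<close>.\<close>

lemma scalar_weak_duality:
  fixes c k z w :: real
  assumes "c < k"
  shows "c * z\<^sup>2 \<le> k * (z - w)\<^sup>2 + k * c / (k - c) * w\<^sup>2"
proof -
  have "k * (z - w)\<^sup>2 + k * c / (k - c) * w\<^sup>2 - c * z\<^sup>2 = ((k - c) * z - k * w)\<^sup>2 / (k - c)"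
    using assms by (simp add: field_simps) (simp add: power2_eq_square algebra_simps)
  also have "\<dots> \<ge> 0" using assms by simp
  finally show ?thesis by simp
qed

text \<open>The scalar inequality, summed over the eigenbasis, bounds the form at \<open>z\<close> by the transport
  cost from \<open>w\<close> and a form at \<open>w\<close>. Integrating against any coupling bounds its cost from below,
  hence also the infimum over couplings.\<close>

lemma wasserstein_weak_duality:
  fixes P0 P :: "'a::euclidean_space measure"
  assumes P0: "P0 \<in> prob2" and P: "P \<in> ambiguity P0 r" and B: "orthonormal_basis B"
    and c: "\<And>b. b \<in> B \<Longrightarrow> c b < k" and k: "0 < k"
  shows "(\<integral>z. (\<Sum>b\<in>B. c b * (z \<bullet> b)\<^sup>2) \<partial>P) \<le> dual_value B (\<lambda>b. \<integral>w. (w \<bullet> b)\<^sup>2 \<partial>P0) c r k"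
proof -
  let ?q = "\<lambda>z. \<Sum>b\<in>B. c b * (z \<bullet> b)\<^sup>2"
  let ?s = "\<lambda>w. \<Sum>b\<in>B. k * c b / (k - c b) * (w \<bullet> b)\<^sup>2"
  let ?cost = "\<lambda>z :: 'a \<times> 'a. (norm (fst z - snd z))\<^sup>2"
  have P2: "P \<in> prob2" and W: "wasserstein2 P P0 \<le> r" using P by (auto simp: ambiguity_def)
  have pointwise: "?q z \<le> k * (norm (z - w))\<^sup>2 + ?s w" for z w
  proof -
    have "?q z \<le> (\<Sum>b\<in>B. k * (z \<bullet> b - w \<bullet> b)\<^sup>2 + k * c b / (k - c b) * (w \<bullet> b)\<^sup>2)"
      using c by (intro sum_mono scalar_weak_duality)
    then show ?thesis
      by (simp add: norm_square_orthonormal[OF B] inner_diff_left sum.distrib sum_distrib_left)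
  qed
  have int: "integrable P ?q" "integrable P0 ?s"
    using prob2_integrable_inner_square[OF P2] prob2_integrable_inner_square[OF P0] by auto
  have "((\<integral>z. ?q z \<partial>P) - (\<integral>w. ?s w \<partial>P0)) / k \<le> (\<integral>z. ?cost z \<partial>\<pi>)" if \<pi>: "\<pi> \<in> couplings P P0" for \<pi>
  proof -
    have meas: "?q \<in> borel_measurable borel" "?s \<in> borel_measurable borel" by measurable
    have int': "integrable \<pi> (\<lambda>z. ?q (fst z))" "integrable \<pi> (\<lambda>z. ?s (snd z))"
      using int couplingsD(1)[OF \<pi> meas(1)] couplingsD(2)[OF \<pi> meas(2)] by simp_all
    have \<pi>2: "\<pi> \<in> prob2" using \<pi> by (simp add: couplings_def)
    have intc: "integrable \<pi> ?cost"
    proof (rule Bochner_Integration.integrable_bound[of \<pi> "\<lambda>z. 2 * (norm z)\<^sup>2"])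
      show "integrable \<pi> (\<lambda>z. 2 * (norm z)\<^sup>2)" using \<pi>2 by (simp add: prob2_def)
      have "sets \<pi> = sets borel" using \<pi>2 by (simp add: prob2_def)
      then show "?cost \<in> borel_measurable \<pi>"
        by (subst measurable_cong_sets[OF _ refl, of \<pi> borel])
          (auto intro!: borel_measurable_continuous_onI continuous_intros)
      have "?cost z \<le> 2 * (norm z)\<^sup>2" for z :: "'a \<times> 'a"
      proof -
        have "(norm (fst z - snd z))\<^sup>2 + (norm (fst z + snd z))\<^sup>2 =
            2 * (norm (fst z))\<^sup>2 + 2 * (norm (snd z))\<^sup>2"
          by (simp add: power2_norm_eq_inner inner_simps inner_commute)
        moreover have "0 \<le> (norm (fst z + snd z))\<^sup>2" by simp
        ultimately show ?thesis unfolding norm_Pair_square distrib_left by linarith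
      qed
      then show "AE z in \<pi>. norm (?cost z) \<le> norm (2 * (norm z)\<^sup>2)" by simp
    qed
    have "(\<integral>z. ?q z \<partial>P) = (\<integral>z. ?q (fst z) \<partial>\<pi>)" by (rule couplingsD(3)[OF \<pi> meas(1)])
    also have "\<dots> \<le> (\<integral>z. k * ?cost z + ?s (snd z) \<partial>\<pi>)"
      using int' intc pointwise by (intro integral_mono) auto
    also have "\<dots> = k * (\<integral>z. ?cost z \<partial>\<pi>) + (\<integral>z. ?s (snd z) \<partial>\<pi>)"
      using int'(2) intc by (subst Bochner_Integration.integral_add) auto
    also have "(\<integral>z. ?s (snd z) \<partial>\<pi>) = (\<integral>w. ?s w \<partial>P0)"
      by (rule couplingsD(4)[OF \<pi> meas(2), symmetric])
    finally show ?thesis using k by (simp add: pos_divide_le_eq mult.commute)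
  qed
  then have "((\<integral>z. ?q z \<partial>P) - (\<integral>w. ?s w \<partial>P0)) / k
      \<le> (INF \<pi>\<in>couplings P P0. \<integral>z. ?cost z \<partial>\<pi>)"
    by (intro cINF_greatest couplings_nonempty P2 P0)
  also have "\<dots> \<le> r\<^sup>2"
    using W unfolding wasserstein2_def by (rule sqrt_le_D)
  finally have "(\<integral>z. ?q z \<partial>P) \<le> k * r\<^sup>2 + (\<integral>w. ?s w \<partial>P0)"
    using k by (simp add: pos_divide_le_eq mult.commute)
  moreover have "(\<integral>w. ?s w \<partial>P0) = (\<Sum>b\<in>B. (\<integral>w. (w \<bullet> b)\<^sup>2 \<partial>P0) * (k * c b / (k - c b)))"
    using prob2_integrable_inner_square[OF P0]
    by (subst Bochner_Integration.integral_sum) (auto simp: mult.commute)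
  ultimately show ?thesis by (simp add: dual_value_def)
qed

text \<open>The equation is the vanishing of the derivative of the dual function in \<open>k\<close>. Its left-hand
  side decreases from infinity to zero on \<open>k > c e\<close>; the blow-up at \<open>c e\<close> needs \<open>m e > 0\<close> and
  \<open>c e > 0\<close>. Explicit points on either side of the solution make the intermediate value theorem
  applicable.\<close>

lemma stationary_multiplier:
  fixes m c :: "'b \<Rightarrow> real" and r :: real
  assumes "finite B" and r: "0 < r" and m: "\<And>b. b \<in> B \<Longrightarrow> 0 \<le> m b"
    and c: "\<And>b. b \<in> B \<Longrightarrow> 0 \<le> c b \<and> c b \<le> c e" and e: "e \<in> B" "0 < m e" "0 < c e"
  obtains k where "c e < k" and "(\<Sum>b\<in>B. m b * (c b / (k - c b))\<^sup>2) = r\<^sup>2"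
proof -
  define g where "g k = (\<Sum>b\<in>B. m b * (c b / (k - c b))\<^sup>2)" for k
  \<comment> \<open>At \<open>k = c e + d1\<close> the summand of \<open>e\<close> alone equals \<open>r\<^sup>2\<close>; at \<open>k = c e + d2\<close> all
      summands, each bounded by \<open>m b * (c e / d2)\<^sup>2\<close>, add up to at most \<open>r\<^sup>2\<close>.\<close>
  define d1 where "d1 = c e * sqrt (m e) / r"
  define d2 where "d2 = c e * sqrt (\<Sum>b\<in>B. m b) / r"
  have le: "m e \<le> (\<Sum>b\<in>B. m b)" using assms by (intro member_le_sum) auto
  have d1: "0 < d1" using r e by (simp add: d1_def)
  have "d1 \<le> d2" unfolding d1_def d2_def
    using le r e by (intro divide_right_mono mult_left_mono real_sqrt_le_mono) auto
  then have d2: "0 < d2" using d1 by simp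
  have "r\<^sup>2 = m e * (c e / (c e + d1 - c e))\<^sup>2"
    using r e by (simp add: d1_def power_divide power_mult_distrib field_simps)
  also have "\<dots> \<le> g (c e + d1)" unfolding g_def using assms
    by (intro member_le_sum[where f = "\<lambda>b. m b * (c b / (c e + d1 - c b))\<^sup>2"]) auto
  finally have g1: "r\<^sup>2 \<le> g (c e + d1)" .
  have "g (c e + d2) \<le> (\<Sum>b\<in>B. m b * (c e / d2)\<^sup>2)"
    unfolding g_def
  proof (intro sum_mono mult_left_mono power_mono m)
    fix b assume b: "b \<in> B"
    show "c b / (c e + d2 - c b) \<le> c e / d2"
      using c[OF b] d2 by (intro frac_le) auto
    show "0 \<le> c b / (c e + d2 - c b)"
      using c[OF b] d2 by simp
  qed
  also have "\<dots> = r\<^sup>2"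
  proof -
    have "0 < (\<Sum>b\<in>B. m b)" using le e by simp
    then show ?thesis using r e
      by (simp add: d2_def power_divide power_mult_distrib
          sum_divide_distrib[symmetric] sum_distrib_right[symmetric])
  qed
  finally have g2: "g (c e + d2) \<le> r\<^sup>2" .
  have "continuous_on {c e + d1..c e + d2} g"
    unfolding g_def using c d1 by (intro continuous_intros) fastforce
  then obtain k where k: "c e + d1 \<le> k" "k \<le> c e + d2" "g k = r\<^sup>2"
    using IVT2'[of g "c e + d2" "r\<^sup>2" "c e + d1"] g1 g2 \<open>d1 \<le> d2\<close> by auto
  then show ?thesis using d1 by (intro that[of k]) (auto simp: g_def)
qed

text \<open>Let \<open>k\<close> be the stationary multiplier and move the mass at \<open>w\<close> to the point where the scalar
  inequality is an equality. Stationarity says that this linear map spends exactly the budget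
  \<open>r\<^sup>2\<close>, so no slack is left in weak duality. The largest eigenvalue of the form must be
  positive, since a zero form has no stationary multiplier.\<close>

lemma wasserstein_strong_duality:
  fixes P0 :: "'a::euclidean_space measure"
  assumes P0: "P0 \<in> prob2" and ac: "absolutely_continuous lborel P0" and r: "0 < r"
    and B: "orthonormal_basis B" and c: "\<And>b. b \<in> B \<Longrightarrow> 0 \<le> c b" and pos: "\<exists>b\<in>B. 0 < c b"
  obtains k P where "0 < k" and "\<And>b. b \<in> B \<Longrightarrow> c b < k" and "P \<in> ambiguity P0 r"
    and "(\<integral>z. (\<Sum>b\<in>B. c b * (z \<bullet> b)\<^sup>2) \<partial>P) = dual_value B (\<lambda>b. \<integral>w. (w \<bullet> b)\<^sup>2 \<partial>P0) c r k"
proof -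
  define m where "m b = (\<integral>w. (w \<bullet> b)\<^sup>2 \<partial>P0)" for b
  have fin: "finite B" using B by (simp add: orthonormal_basis_def)
  have mpos: "0 < m b" if "b \<in> B" for b
    unfolding m_def using B that
    by (intro directional_second_moment_pos[OF P0 ac]) (auto simp: orthonormal_basis_def)
  have "Max (c ` B) \<in> c ` B" using fin pos by (intro Max_in) auto
  then obtain e where "e \<in> B" and "c e = Max (c ` B)" by auto
  then have e: "e \<in> B" "\<And>b. b \<in> B \<Longrightarrow> c b \<le> c e" using fin by auto
  obtain b0 where "b0 \<in> B" "0 < c b0" using pos by blast
  then have ce: "e \<in> B" "0 < c e" using e(1) e(2)[of b0] by auto
  obtain k where k: "c e < k" and stat: "(\<Sum>b\<in>B. m b * (c b / (k - c b))\<^sup>2) = r\<^sup>2"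
  proof (rule stationary_multiplier[of B r m c e])
    show "0 \<le> m b" if "b \<in> B" for b using mpos[OF that] by simp
    show "0 < m e" using mpos e(1) .
  qed (use fin r c e ce in auto)
  have ck: "c b < k" if "b \<in> B" for b using e(2)[OF that] k by simp
  have k0: "0 < k" using k ce by simp
  define T where "T w = (\<Sum>b\<in>B. (k / (k - c b) * (w \<bullet> b)) *\<^sub>R b)" for w :: 'a
  have Tb: "T w \<bullet> b = k / (k - c b) * (w \<bullet> b)" if "b \<in> B" for w b
    unfolding T_def by (rule inner_orthonormal_sum[OF B that])
  have T: "T \<in> borel_measurable borel"
    unfolding T_def by measurable
  have sets: "sets P0 = sets borel" using P0 by (simp add: prob2_def)
  have T0: "T \<in> measurable P0 borel" using T by (simp add: measurable_cong_sets[OF sets refl])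
  have int: "integrable P0 (\<lambda>w. (w \<bullet> b)\<^sup>2)" for b by (rule prob2_integrable_inner_square[OF P0])
  have nT: "(norm (T w))\<^sup>2 = (\<Sum>b\<in>B. (k / (k - c b))\<^sup>2 * (w \<bullet> b)\<^sup>2)" for w
    by (simp add: norm_square_orthonormal[OF B] Tb power_mult_distrib power_divide)
  have nTd: "(norm (T w - w))\<^sup>2 = (\<Sum>b\<in>B. (c b / (k - c b))\<^sup>2 * (w \<bullet> b)\<^sup>2)" for w
  proof -
    have "(T w - w) \<bullet> b = c b / (k - c b) * (w \<bullet> b)" if "b \<in> B" for b
      using ck[OF that] by (simp add: inner_diff_left Tb[OF that] field_simps)
    then show ?thesis by (simp add: norm_square_orthonormal[OF B] power_mult_distrib power_divide)
  qed
  have "distr P0 borel T \<in> ambiguity P0 r"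
  proof (rule pushforward_in_ambiguity[OF P0 T])
    show "integrable P0 (\<lambda>w. (norm (T w))\<^sup>2)" unfolding nT using int by simp
    have "(\<integral>w. (norm (T w - w))\<^sup>2 \<partial>P0) = r\<^sup>2"
      unfolding nTd stat[symmetric] m_def using int
      by (subst Bochner_Integration.integral_sum) (auto simp: mult.commute)
    then show "(\<integral>w. (norm (T w - w))\<^sup>2 \<partial>P0) \<le> r\<^sup>2" by simp
  qed (use r in simp)
  moreover have "(\<integral>z. (\<Sum>b\<in>B. c b * (z \<bullet> b)\<^sup>2) \<partial>distr P0 borel T) = dual_value B m c r k"
  proof -
    have "(\<integral>z. (\<Sum>b\<in>B. c b * (z \<bullet> b)\<^sup>2) \<partial>distr P0 borel T) =
        (\<integral>w. (\<Sum>b\<in>B. c b * (T w \<bullet> b)\<^sup>2) \<partial>P0)"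
      by (rule integral_distr[OF T0]) measurable
    also have "\<dots> = (\<integral>w. (\<Sum>b\<in>B. c b * (k / (k - c b))\<^sup>2 * (w \<bullet> b)\<^sup>2) \<partial>P0)"
      by (simp add: Tb power_mult_distrib power_divide mult.assoc)
    also have "\<dots> = (\<Sum>b\<in>B. c b * (k / (k - c b))\<^sup>2 * m b)"
      unfolding m_def using int by (subst Bochner_Integration.integral_sum) auto
    also have "\<dots> = (\<Sum>b\<in>B. k * (m b * (c b / (k - c b))\<^sup>2) + m b * (k * c b / (k - c b)))"
    proof (rule sum.cong[OF refl])
      fix b assume b: "b \<in> B"
      show "c b * (k / (k - c b))\<^sup>2 * m b =
          k * (m b * (c b / (k - c b))\<^sup>2) + m b * (k * c b / (k - c b))"
        using ck[OF b] by (simp add: divide_simps) (simp add: power2_eq_square algebra_simps)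
    qed
    also have "\<dots> = dual_value B m c r k"
      by (simp add: dual_value_def sum.distrib sum_distrib_left[symmetric] stat)
    finally show ?thesis .
  qed
  ultimately show ?thesis
    using that[OF k0 ck, of "distr P0 borel T"] unfolding m_def by blast
qed

section \<open>Regret as a quadratic form\<close>

lemma pd_Dmat:
  assumes Q: "psd Q" and R: "pd R"
  shows "pd (Dmat A B Q R)"
proof -
  have "transpose (Dmat A B Q R) = Dmat A B Q R"
    using Q R by (simp add: Dmat_def transpose_add transpose_weighted_gram psd_def pd_def)
  moreover have "0 < v \<bullet> (Dmat A B Q R *v v)" if "v \<noteq> 0" for v
    using Q R that
    by (simp add: Dmat_def matrix_vector_mult_add_rdistrib inner_add_right weighted_gram_form
        psd_def pd_def add_pos_nonneg)
  ultimately show ?thesis by (simp add: pd_def)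
qed

text \<open>The noncausal controller minimises the cost pointwise, by completing the square in \<open>u\<close>.\<close>

lemma cost_square:
  fixes Q :: "real^('t::{finite,linorder} option \<times> 'n::finite)^('t option \<times> 'n)"
    and R :: "real^('t \<times> 'm::finite)^('t \<times> 'm)"
  assumes Q: "psd Q" and R: "pd R"
  shows "cost A B Q R u w = cost A B Q R (Kstar A B Q R *v w) w +
    (u - Kstar A B Q R *v w) \<bullet> (Dmat A B Q R *v (u - Kstar A B Q R *v w))"
proof -
  let ?F = "Fmat A B :: real^('t \<times> 'm)^('t option \<times> 'n)"
  let ?G = "Gmat A :: real^('t option \<times> 'n)^('t option \<times> 'n)"
  let ?D = "Dmat A B Q R" and ?z = "Kstar A B Q R *v w"
  define y where "y = transpose ?F *v (Q *v (?G *v w))"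
  define e where "e = (?G *v w) \<bullet> (Q *v (?G *v w)) - y \<bullet> (matrix_inv ?D *v y)"
  have D: "pd ?D" by (rule pd_Dmat[OF assms])
  have "(- N) *v w = - (N *v w)" for N :: "real^('t option \<times> 'n)^('t \<times> 'm)"
    by (simp add: vec_eq_iff matrix_vector_mult_def sum_negf)
  then have z: "?z = - (matrix_inv ?D *v y)"
    by (simp add: Kstar_def y_def matrix_vector_mul_assoc[symmetric] del: transpose_matrix_vector)
  have "cost A B Q R v w = (v - ?z) \<bullet> (?D *v (v - ?z)) + e" for v
  proof -
    have cross: "(?F *v v) \<bullet> (Q *v (?G *v w)) = v \<bullet> y"
      using inner_transpose[of ?F "Q *v (?G *v w)" v]
      by (simp only: y_def inner_commute[of v] inner_commute[of "?F *v v"])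
    have cross': "(?G *v w) \<bullet> (Q *v (?F *v v)) = (?F *v v) \<bullet> (Q *v (?G *v w))"
      using inner_transpose[of Q "?G *v w" "?F *v v"] Q
      by (simp add: psd_def inner_commute del: transpose_matrix_vector)
    have "cost A B Q R v w = v \<bullet> (?D *v v) + 2 * (v \<bullet> y) + (?G *v w) \<bullet> (Q *v (?G *v w))"
      unfolding cost_def Let_def Dmat_def
      by (simp add: matrix_vector_right_distrib matrix_vector_mult_add_rdistrib inner_add_left
          inner_add_right weighted_gram_form cross cross')
    also have "v \<bullet> (?D *v v) + 2 * (v \<bullet> y) =
        (v + matrix_inv ?D *v y) \<bullet> (?D *v (v + matrix_inv ?D *v y)) - y \<bullet> (matrix_inv ?D *v y)"
      using pd_inverse[OF D] D by (intro complete_square) (auto simp: pd_def)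
    finally show ?thesis by (simp add: z e_def)
  qed
  from this[of u] this[of ?z] show ?thesis by simp
qed

lemma regret_form:
  assumes Q: "psd Q" and R: "pd R" and L: "L = K - Kstar A B Q R"
  shows "regret A B Q R K w = w \<bullet> ((transpose L ** Dmat A B Q R ** L) *v w)"
proof -
  let ?z = "Kstar A B Q R *v w"
  have "0 \<le> v \<bullet> (Dmat A B Q R *v v)" for v
    using pd_imp_psd[OF pd_Dmat[OF Q R]] by (simp add: psd_def)
  then have "cost A B Q R ?z w \<le> cost A B Q R u w" for u
    by (subst (2) cost_square[OF Q R]) simp
  then have "cost A B Q R (ustar A B Q R w) w = cost A B Q R ?z w"
    unfolding ustar_def by (intro arg_min_equality) auto
  then show ?thesis
    using cost_square[OF Q R, of A B "K *v w" w]
    by (simp add: regret_def weighted_gram_form L matrix_vector_mult_diff_rdistrib)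
qed

section \<open>The semidefinite program is the dual\<close>

text \<open>With \<open>k\<close> the first component of a feasible pair, weak duality bounds every expected regret by
  the dual value at \<open>k\<close>, which bounds the objective from below. Conversely the stationary multiplier
  together with the optimal \<open>X\<close> is feasible and its objective is an attained expected regret.\<close>

lemma worst_case_regret_eq_sdp:
  fixes Q :: "real^('t::{finite,linorder} option \<times> 'n::finite)^('t option \<times> 'n)"
    and R :: "real^('t \<times> 'm::finite)^('t \<times> 'm)"
  assumes Q: "psd Q" and R: "pd R" and r: "r > 0"
    and P0: "P0 \<in> prob2" and ac: "absolutely_continuous lborel P0"
    and K: "K \<in> causal" and K_neq: "K \<noteq> Kstar A B Q R"
  shows "worst_case_regret A B Q R P0 r K =
    (INF (\<gamma>, X)\<in>{(\<gamma>, X). (K, \<gamma>, X) \<in> sdp_feasible A B Q R (second_moment P0)}.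
       ereal (sdp_objective (second_moment P0) r \<gamma> X))"
    (is "?sup = ?inf")
proof -
  let ?D = "Dmat A B Q R" and ?M = "second_moment P0"
  define L where "L = K - Kstar A B Q R"
  define C where "C = transpose L ** ?D ** L"
  define constr where "constr X k = vcat (hcat X (hcat (k *\<^sub>R msqrt ?M) (transpose 0)))
            (vcat (hcat (k *\<^sub>R msqrt ?M) (hcat (mat k) (transpose L)))
                  (hcat 0 (hcat L (matrix_inv ?D))))" for X k
  have D: "pd ?D" by (rule pd_Dmat[OF Q R])
  have symC: "transpose C = C" using D by (simp add: C_def transpose_weighted_gram pd_def)
  have formC: "x \<bullet> (C *v x) = (L *v x) \<bullet> (?D *v (L *v x))" for x
    by (simp only: C_def weighted_gram_form)
  obtain B' where B': "orthonormal_basis B'"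
    and eig': "\<And>b. b \<in> B' \<Longrightarrow> C *v b = (b \<bullet> (C *v b)) *\<^sub>R b"
    using symmetric_eigenbasis[OF symC] by blast
  define c where "c b = b \<bullet> (C *v b)" for b
  have eig: "C *v b = c b *\<^sub>R b" if "b \<in> B'" for b using eig'[OF that] by (simp only: c_def)
  have c0: "0 \<le> c b" for b
    using pd_imp_psd[OF D] by (simp add: c_def formC psd_def)
  have regret: "regret A B Q R K w = (\<Sum>b\<in>B'. c b * (w \<bullet> b)\<^sup>2)" for w
    using regret_form[OF Q R L_def, of w] eigenbasis_form[OF B' eig symC, of w w]
    by (simp add: C_def[symmetric] power2_eq_square mult.assoc)
  \<comment> \<open>The form does not vanish, because \<open>D\<close> is definite and \<open>L\<close> is not zero.\<close>
  have pos: "\<exists>b\<in>B'. 0 < c b"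
  proof -
    have "L \<noteq> 0" using K_neq by (simp add: L_def)
    then obtain x where "L *v x \<noteq> 0" by (metis matrix_eq matrix_vector_mult_0)
    then have "0 < x \<bullet> (C *v x)" using D by (simp add: formC pd_def)
    then have "(\<Sum>b\<in>B'. c b * (x \<bullet> b) * (x \<bullet> b)) \<noteq> 0"
      using eigenbasis_form[OF B' eig symC, of x x] by simp
    then obtain b where b: "b \<in> B'" "c b * (x \<bullet> b) * (x \<bullet> b) \<noteq> 0"
      by (rule sum.not_neutral_contains_not_neutral)
    then have "c b \<noteq> 0" by auto
    then show ?thesis using b(1) c0[of b] by (intro bexI[of _ b]) auto
  qed
  have M: "psd ?M" by (rule psd_second_moment[OF P0])
  have m: "b \<bullet> (?M *v b) = (\<integral>w. (w \<bullet> b)\<^sup>2 \<partial>P0)" for b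
    by (rule second_moment_form[OF P0])
  have feasible: "(K, k, X) \<in> sdp_feasible A B Q R ?M \<longleftrightarrow>
      (\<forall>b\<in>B'. c b < k) \<and> psd X \<and> psd (constr X k)" for k X
  proof -
    have "(K, k, X) \<in> sdp_feasible A B Q R ?M \<longleftrightarrow> 0 \<le> k \<and> psd X \<and>
        pd (vcat (hcat (mat k) (transpose L)) (hcat L (matrix_inv ?D))) \<and> psd (constr X k)"
      using K by (simp add: sdp_feasible_def Let_def constr_def L_def)
    also have "pd (vcat (hcat (mat k) (transpose L)) (hcat L (matrix_inv ?D))) \<longleftrightarrow>
        (\<forall>b\<in>B'. c b < k)"
      unfolding schur_definite[OF D] C_def[symmetric] by (rule pd_shift_iff[OF B' eig symC])
    finally show ?thesis using pos by (auto intro: less_imp_le less_trans)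
  qed
  have "?sup \<le> ?inf"
    unfolding worst_case_regret_def
  proof (intro SUP_least INF_greatest, clarify)
    fix P k X
    assume P: "P \<in> ambiguity P0 r" and "(K, k, X) \<in> sdp_feasible A B Q R ?M"
    then have k: "\<And>b. b \<in> B' \<Longrightarrow> c b < k" and X: "psd (constr X k)" by (auto simp: feasible)
    have "0 < k" using pos k by (auto intro: less_trans)
    then have "(\<integral>w. regret A B Q R K w \<partial>P) \<le> dual_value B' (\<lambda>b. b \<bullet> (?M *v b)) c r k"
      unfolding regret m using wasserstein_weak_duality[OF P0 P B' k] by simp
    also have "\<dots> \<le> sdp_objective ?M r k X"
      using sdp_minimum_over_X(1)[OF D M B', of L c k] eig k X unfolding C_def constr_def by blast
    finally show "ereal (\<integral>w. regret A B Q R K w \<partial>P) \<le> ereal (sdp_objective ?M r k X)" by simp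
  qed
  moreover have "?inf \<le> ?sup"
  proof -
    obtain k P where k: "\<And>b. b \<in> B' \<Longrightarrow> c b < k" and P: "P \<in> ambiguity P0 r"
      and opt: "(\<integral>w. regret A B Q R K w \<partial>P) = dual_value B' (\<lambda>b. b \<bullet> (?M *v b)) c r k"
      unfolding regret m using wasserstein_strong_duality[OF P0 ac r B' c0 pos] by blast
    obtain X where X: "psd X" "psd (constr X k)"
      and obj: "sdp_objective ?M r k X = dual_value B' (\<lambda>b. b \<bullet> (?M *v b)) c r k"
      using sdp_minimum_over_X(2)[OF D M B', of L c k r] eig k unfolding C_def constr_def by blast
    have "?inf \<le> ereal (sdp_objective ?M r k X)"
      using feasible k X by (intro INF_lower2[of "(k, X)"]) auto
    also have "\<dots> = ereal (\<integral>w. regret A B Q R K w \<partial>P)" by (simp only: obj opt)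
    also have "\<dots> \<le> ?sup"
      unfolding worst_case_regret_def using P by (intro SUP_upper)
    finally show ?thesis .
  qed
  ultimately show ?thesis by (rule antisym)
qed

text \<open>No causal controller equals the noncausal one, so the preceding lemma applies to each \<open>K\<close>. The
  feasible set of the program is the union of its slices over \<open>K\<close>, which gives the equality of the
  optimal values.\<close>

theorem theorem4:
  fixes A :: "nat \<Rightarrow> real^'n^'n" and B :: "nat \<Rightarrow> real^'m^'n"
    and Q :: "real^('t::{finite,linorder} option \<times> 'n)^('t option \<times> 'n)"
    and R :: "real^('t \<times> 'm)^('t \<times> 'm)"
    and P0 :: "(real^('t option \<times> 'n)) measure" and r :: real
  assumes "psd Q" and "pd R"
    and "r > 0"
    and "P0 \<in> prob2" and "absolutely_continuous lborel P0"
    and "Kstar A B Q R \<notin> causal"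
  shows "(\<forall>K\<in>causal. worst_case_regret A B Q R P0 r K =
            (INF (\<gamma>, X)\<in>{(\<gamma>, X). (K, \<gamma>, X) \<in> sdp_feasible A B Q R (second_moment P0)}.
               ereal (sdp_objective (second_moment P0) r \<gamma> X))) \<and>
         (INF K\<in>causal. worst_case_regret A B Q R P0 r K) =
            (INF (K, \<gamma>, X)\<in>sdp_feasible A B Q R (second_moment P0).
               ereal (sdp_objective (second_moment P0) r \<gamma> X))"
proof
  let ?feas = "sdp_feasible A B Q R (second_moment P0)"
  let ?obj = "\<lambda>\<gamma> X. ereal (sdp_objective (second_moment P0) r \<gamma> X)"
  show eq: "\<forall>K\<in>causal. worst_case_regret A B Q R P0 r K =
      (INF (\<gamma>, X)\<in>{(\<gamma>, X). (K, \<gamma>, X) \<in> ?feas}. ?obj \<gamma> X)"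
    using assms by (intro ballI worst_case_regret_eq_sdp) auto
  have "(INF K\<in>causal. worst_case_regret A B Q R P0 r K) =
      (INF K\<in>causal. INF (\<gamma>, X)\<in>{(\<gamma>, X). (K, \<gamma>, X) \<in> ?feas}. ?obj \<gamma> X)"
    using eq by (intro INF_cong) auto
  also have "\<dots> = (INF (K, \<gamma>, X)\<in>?feas. ?obj \<gamma> X)"
  proof (rule antisym)
    show "(INF K\<in>causal. INF (\<gamma>, X)\<in>{(\<gamma>, X). (K, \<gamma>, X) \<in> ?feas}. ?obj \<gamma> X)
        \<le> (INF (K, \<gamma>, X)\<in>?feas. ?obj \<gamma> X)"
    proof (intro INF_greatest, clarify)
      fix K \<gamma> X assume feas: "(K, \<gamma>, X) \<in> ?feas"
      then have "K \<in> causal" by (simp add: sdp_feasible_def)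
      then show "(INF K\<in>causal. INF (\<gamma>, X)\<in>{(\<gamma>, X). (K, \<gamma>, X) \<in> ?feas}. ?obj \<gamma> X) \<le> ?obj \<gamma> X"
        using feas by (intro INF_lower2[of K] INF_lower2[of "(\<gamma>, X)"]) auto
    qed
    show "(INF (K, \<gamma>, X)\<in>?feas. ?obj \<gamma> X)
        \<le> (INF K\<in>causal. INF (\<gamma>, X)\<in>{(\<gamma>, X). (K, \<gamma>, X) \<in> ?feas}. ?obj \<gamma> X)"
      by (intro INF_greatest, clarify) (rule INF_lower2, auto)
  qed
  finally show "(INF K\<in>causal. worst_case_regret A B Q R P0 r K) = (INF (K, \<gamma>, X)\<in>?feas. ?obj \<gamma> X)" .
qed

end
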